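(* Let $\mu\in\mathbb R$, $\delta>0$, and let $(X_n)$ be a sequence of iid random variables with a $\mathcal P$-uniformly bounded $(2+\delta)$-th moment for some $\mathcal P\subseteq\mathcal M_{2+\delta}(\mu)$. Fix $C,\rho>0$ and for integers $k\ge m\ge2$ let $\hat u_k^{(m)}=k(\hat s_k^2+1/\log m)$. Then $$\mathcal H_k^{(m)}(\alpha)=\left(\overline X_k\pm\sqrt{\frac{2\rho\hat u_k^{(m)}+2}{k^2\rho}\log\left(\frac{\sqrt{\rho\hat u_k^{(m)}+1}}{\alpha}\right)}\right)$$ forms a $\mathcal P$-uniform asymptotic post-hoc confidence sequence for $\mu$ with range growth function $f(m)=C\,m^{-0.24\,\delta}$; that is, for any stopping time $\tau$, $$\limsup_{m\to\infty}\sup_{P\in\mathcal P}\mathbb E_P\left[\sup_{\alpha>f(m)}\frac{\mathbf 1\{\mu\notin\mathcal H^{(m)}_{\tau\vee m}(\alpha)\}}{\alpha}\right]\le1.$$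
   Context: Under $P$, $X_1,X_2,\dots$ are iid with law $P$. Stopping times are $\mathbb N$-valued and taken with respect to $\mathcal F_n=\sigma(X_1,\dots,X_n)$. $\overline X_k=k^{-1}\sum_{i\le k}X_i$, $\hat s_k^2=k^{-1}\sum_{i\le k}(X_i-\overline X_k)^2$, $a\vee b=\max(a,b)$, and $(x\pm w)$ is the open interval $(x-w,x+w)$, taken to be empty when $w=0$ or when the logarithm under the square root is negative (possible only for $\alpha>1$). $\mathcal M_q(\mu)$ is the set of distributions $P$ on $\mathbb R$ with mean $\mu$ and $\mathbb E_P|X_1-\mu|^q<\infty$. $\mathcal P$-uniformly bounded $q$-th moment means $\sup_{P\in\mathcal P}\mathbb E_P|X_1|^q<\infty$. *)

theory Defs
  imports "HOL-Probability.Probability"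
begin

text \<open>Laws on \<open>\<real>\<close> are Borel measures of type \<^typ>\<open>real measure\<close>. The class \<open>\<M>\<^sub>q(\<mu>)\<close>:\<close>

definition moment_class :: "real \<Rightarrow> real \<Rightarrow> real measure set" where
  "moment_class q \<mu> = {P. prob_space P \<and> sets P = sets borel \<and>
     integrable P (\<lambda>x. x) \<and> (\<integral>x. x \<partial>P) = \<mu> \<and>
     integrable P (\<lambda>x. \<bar>x - \<mu>\<bar> powr q)}"

definition uniformly_bounded_moment :: "real measure set \<Rightarrow> real \<Rightarrow> bool" where
  "uniformly_bounded_moment \<P> q \<longleftrightarrow> (SUP P\<in>\<P>. \<integral>\<^sup>+x. ennreal (\<bar>x\<bar> powr q) \<partial>P) < \<infinity>"

text \<open>Observations are indexed from 1, as \<open>X 1, X 2, \<dots>\<close>; \<open>X 0\<close> is never used.\<close>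

definition iid_with_law :: "'w measure \<Rightarrow> (nat \<Rightarrow> 'w \<Rightarrow> real) \<Rightarrow> real measure \<Rightarrow> bool" where
  "iid_with_law M X P \<longleftrightarrow> prob_space M \<and> prob_space.indep_vars M (\<lambda>_. borel) X {1..} \<and>
     (\<forall>i\<ge>1. distr M borel (X i) = P)"

text \<open>The statistical model: one measurable space \<open>\<Omega>\<close> and one sequence \<open>X\<close>, with a probability
  measure \<open>\<PP> P\<close> on \<open>\<Omega>\<close> for every law \<open>P\<close> in the class, under which \<open>X\<close> is iid with law \<open>P\<close>.
  Only the \<open>\<sigma>\<close>-algebra of \<open>\<Omega>\<close> matters, not its measure.\<close>

definition iid_model ::
  "'w measure \<Rightarrow> (nat \<Rightarrow> 'w \<Rightarrow> real) \<Rightarrow> (real measure \<Rightarrow> 'w measure) \<Rightarrow> real measure set \<Rightarrow> bool" where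
  "iid_model \<Omega> X \<PP> \<P> \<longleftrightarrow> (\<forall>P\<in>\<P>. sets (\<PP> P) = sets \<Omega> \<and> iid_with_law (\<PP> P) X P)"

definition natural_filtration ::
  "'w measure \<Rightarrow> (nat \<Rightarrow> 'w \<Rightarrow> real) \<Rightarrow> nat \<Rightarrow> 'w measure" where
  "natural_filtration \<Omega> X n =
     sigma (space \<Omega>) {X i -` B \<inter> space \<Omega> | i B. i \<in> {1..n} \<and> B \<in> sets borel}"

definition sample_mean :: "(nat \<Rightarrow> 'w \<Rightarrow> real) \<Rightarrow> nat \<Rightarrow> 'w \<Rightarrow> real" where
  "sample_mean X k \<omega> = (\<Sum>i=1..k. X i \<omega>) / real k"

definition sample_var :: "(nat \<Rightarrow> 'w \<Rightarrow> real) \<Rightarrow> nat \<Rightarrow> 'w \<Rightarrow> real" where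
  "sample_var X k \<omega> = (\<Sum>i=1..k. (X i \<omega> - sample_mean X k \<omega>)\<^sup>2) / real k"

definition u_hat :: "(nat \<Rightarrow> 'w \<Rightarrow> real) \<Rightarrow> nat \<Rightarrow> nat \<Rightarrow> 'w \<Rightarrow> real" where
  "u_hat X m k \<omega> = real k * (sample_var X k \<omega> + 1 / ln (real m))"

text \<open>\<open>sqrt\<close> is odd on the reals, so the half-width below is negative when the logarithm is; the
  open interval is then empty, as it is for half-width zero. This is the intended convention.\<close>

definition half_width ::
  "(nat \<Rightarrow> 'w \<Rightarrow> real) \<Rightarrow> real \<Rightarrow> nat \<Rightarrow> nat \<Rightarrow> real \<Rightarrow> 'w \<Rightarrow> real" where
  "half_width X \<rho> m k \<alpha> \<omega> =
     sqrt ((2 * \<rho> * u_hat X m k \<omega> + 2) / ((real k)\<^sup>2 * \<rho>)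
           * ln (sqrt (\<rho> * u_hat X m k \<omega> + 1) / \<alpha>))"

definition conf_interval ::
  "(nat \<Rightarrow> 'w \<Rightarrow> real) \<Rightarrow> real \<Rightarrow> nat \<Rightarrow> nat \<Rightarrow> real \<Rightarrow> 'w \<Rightarrow> real set" where
  "conf_interval X \<rho> m k \<alpha> \<omega> =
     {sample_mean X k \<omega> - half_width X \<rho> m k \<alpha> \<omega> <..< sample_mean X k \<omega> + half_width X \<rho> m k \<alpha> \<omega>}"

text \<open>\<open>H m k \<alpha> \<omega>\<close> is the level-\<open>\<alpha>\<close> set at time \<open>k \<ge> m\<close> in the \<open>m\<close>-th sequence. The stopping time
  is fixed before \<open>m\<close> and \<open>P\<close>; being defined on \<open>\<Omega>\<close>, it does not depend on them.\<close>

definition uniform_asymp_posthoc_conf_seq ::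
  "'w measure \<Rightarrow> (nat \<Rightarrow> 'w \<Rightarrow> real) \<Rightarrow> (real measure \<Rightarrow> 'w measure) \<Rightarrow> real measure set \<Rightarrow> real \<Rightarrow>
   (nat \<Rightarrow> nat \<Rightarrow> real \<Rightarrow> 'w \<Rightarrow> real set) \<Rightarrow> (nat \<Rightarrow> real) \<Rightarrow> bool" where
  "uniform_asymp_posthoc_conf_seq \<Omega> X \<PP> \<P> \<mu> H f \<longleftrightarrow>
     (\<forall>\<tau>. stopping_time (natural_filtration \<Omega> X) \<tau> \<longrightarrow>
        limsup (\<lambda>m. SUP P\<in>\<P>. \<integral>\<^sup>+\<omega>.
          (SUP \<alpha>\<in>{f m<..}. ennreal (of_bool (\<mu> \<notin> H m (max (\<tau> \<omega>) m) \<alpha> \<omega>) / \<alpha>)) \<partial>\<PP> P) \<le> 1)"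

end

theory Submission
  imports Defs "HOL-Real_Asymp.Real_Asymp"
begin

text \<open>
Write \<open>S\<^sub>k = \<Sum>\<^bsub>i\<le>k\<^esub> (X\<^sub>i - \<mu>)\<close> and \<open>\<Lambda> = ln m\<close>. Solving the inequality that defines the
interval for \<open>\<alpha>\<close> shows that level \<open>\<alpha>\<close> can miss \<open>\<mu>\<close> only if
\<open>1/\<alpha> \<le> G(S\<^sub>k, u\<^sub>k)\<close>, where \<open>u\<^sub>k\<close> is the variance estimate \<open>u_hat\<close> and
\<open>G(S, V) = exp (\<rho> S\<^sup>2 / (2 (\<rho> V + 1))) / sqrt (\<rho> V + 1)\<close> (\<open>miscoverage_imp_evalue\<close>). The supremum over
\<open>\<alpha> > f(m)\<close> is therefore at most \<open>G(S\<^sub>k, u\<^sub>k)\<close>, and trivially at most \<open>1/f(m)\<close>. The second bound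
pays for an exceptional event of probability \<open>o(f(m))\<close>; off that event the first one is compared
with a nonnegative supermartingale of initial value at most 1.

The supermartingale comes from the identity \<open>G(S, V) = \<integral> exp (l S - l\<^sup>2 V / 2) dN(0,\<rho>)(l)\<close>
(\<open>nn_integral_mixture\<close>). With only \<open>2 + \<delta>\<close> moments \<open>exp (l S\<^sub>k - \<dots>)\<close> need not be integrable, so
two truncations are made. The observation \<open>X\<^sub>i - \<mu>\<close> is cut at \<open>b\<^sub>i = max(i,m)\<close> to the power
\<open>1/2 - 4\<eta>\<close> and recentred, which gives a martingale \<open>W\<^sub>k\<close>; and the mixture is restricted to
\<open>\<bar>l\<bar> \<le> c\<^sub>k\<close>, where \<open>c\<^sub>k = max(k,m)\<close> to the power \<open>2\<eta> - 1/2\<close>. Since \<open>b\<^sub>i c\<^sub>i\<close> tends to 0, every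
remaining \<open>l\<close> sees an increment whose moment generating function is at most
\<open>exp (l\<^sup>2 s / 2)\<close> with \<open>s = v + 1/(2\<Lambda>)\<close>, \<open>v\<close> the variance. Shrinking the range of \<open>l\<close> as \<open>k\<close> grows
only lowers the integral, so \<open>N\<^sub>k = \<integral>\<^bsub>\<bar>l\<bar>\<le>c\<^sub>k\<^esub> exp (l W\<^sub>k - l\<^sup>2 k s / 2) dN(0,\<rho>)(l)\<close> is a supermartingale
and its value at any stopping time has expectation at most 1 (\<open>nn_integral_mixture_stopped\<close>).

On the complement of the exceptional event three things hold for all \<open>k \<ge> m\<close> at once: no truncation
takes effect; \<open>\<bar>W\<^sub>k\<bar>\<close> is at most \<open>k\<close> to the power \<open>1/2 + \<eta>\<close>; and the sum of squares is at least
\<open>k (v - 1/(4\<Lambda>))\<close>. The last two fail with probability smaller than any power of \<open>m\<close>; the first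
fails with probability \<open>O(m powr (-\<delta>/4))\<close>, by Markov's inequality and a union bound, and this is
where the exponent \<open>0.24 \<delta> < \<delta>/4\<close> is decided (\<open>prob_exceptional\<close>). There
\<open>u\<^sub>k \<ge> k s\<close>, because the summand \<open>1/\<Lambda>\<close> of the estimator covers the loss in the sum of squares, the squared
sample mean, and the excess of \<open>s\<close> over \<open>v\<close>. Moreover \<open>S\<^sub>k - W\<^sub>k\<close>
is a truncation bias of order at most \<open>k\<close> to the power \<open>1/2 - 2\<eta>\<close>, which changes \<open>G\<close> only by a
factor close to 1, and the part \<open>\<bar>l\<bar> > c\<^sub>k\<close> of the Gaussian integral is negligible. Hence
\<open>G(S\<^sub>k, u\<^sub>k) \<le> (1 + o(1)) (N\<^sub>k + o(1))\<close> uniformly in \<open>k \<ge> m\<close> (\<open>evalue_le_mixture\<close>).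
All error terms depend on the law only through a bound \<open>K\<close> for its centred absolute moment of order
\<open>2 + \<delta>\<close>, so the bound is uniform over the class.
\<close>

section \<open>Elementary inequalities\<close>

text \<open>For \<open>x \<le> 1\<close> this is weaker than the second order Taylor bound, for \<open>x \<ge> 1\<close> it is trivial. It controls the
Laplace transform of a nonnegative variable by a moment of order \<open>1 + d\<close> only.\<close>

lemma exp_minus_le_powr:
  fixes x d :: real
  assumes "0 \<le> x" "0 < d" "d \<le> 1"
  shows "exp (- x) \<le> 1 - x + x powr (1 + d)"
proof (cases "x \<le> 1")
  case True
  have "exp (- x) \<le> 1 - x + x\<^sup>2 / 2"
  proof -
    obtain t where t: "\<bar>t\<bar> \<le> \<bar>-x\<bar>" and e: "exp (-x) = (\<Sum>m<3. ((-x) ^ m) / fact m) + (exp t / fact 3) * (-x) ^ 3"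
      using Maclaurin_exp_le[of "-x" 3] by auto
    have "(exp t / fact 3) * (-x) ^ 3 = - ((exp t / fact 3) * x^3)" by simp
    also have "\<dots> \<le> 0" using assms by simp
    finally show ?thesis using e by (simp add: numeral_3_eq_3 power2_eq_square)
  qed
  also have "x\<^sup>2 / 2 \<le> x powr (1 + d)"
  proof (cases "x = 0")
    case False
    then have "x\<^sup>2 = x powr 2" using assms by (simp add: powr_numeral)
    also have "\<dots> \<le> x powr (1 + d)" using assms True False by (intro powr_mono') auto
    finally show ?thesis using zero_le_power2[of x] by linarith
  qed simp
  finally show ?thesis by simp
next
  case False
  have "x powr 1 \<le> x powr (1 + d)" using False assms by (intro powr_mono) auto
  then have "x \<le> x powr (1 + d)" using assms by simp
  moreover have "exp (-x) \<le> 1" using assms by simp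
  ultimately show ?thesis by linarith
qed

text \<open>The quadratic coefficient is \<open>1/2\<close> up to a factor that tends to 1 with \<open>x\<close>; a bound with a
worse constant would spoil the limit 1 of the risk.\<close>

lemma exp_le_quadratic_cubic:
  fixes x :: real
  assumes "\<bar>x\<bar> \<le> 1"
  shows "exp x \<le> 1 + x + x\<^sup>2 / 2 * (1 + \<bar>x\<bar>)"
proof -
  obtain t where t: "\<bar>t\<bar> \<le> \<bar>x\<bar>" and e: "exp x = (\<Sum>m<3. (x ^ m) / fact m) + (exp t / fact 3) * x ^ 3"
    using Maclaurin_exp_le[of x 3] by auto
  have "exp t \<le> exp 1" using t assms by simp
  then have t3: "exp t \<le> 3" using exp_le by linarith
  have "(exp t / fact 3) * x ^ 3 \<le> (exp t / 6) * \<bar>x\<bar> ^ 3"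
  proof -
    have "x^3 \<le> \<bar>x\<bar>^3" by (metis abs_ge_self power_abs)
    then show ?thesis by (simp add: fact_numeral mult_left_mono divide_right_mono)
  qed
  also have "\<dots> \<le> (3 / 6) * \<bar>x\<bar> ^ 3" using t3 by (intro mult_right_mono) auto
  also have "\<dots> = x\<^sup>2 / 2 * \<bar>x\<bar>" by (simp add: power3_eq_cube power2_eq_square)
  finally show ?thesis using e by (simp add: numeral_3_eq_3 power2_eq_square algebra_simps)
qed

text \<open>The discrete form of \<open>\<integral> x powr (r - 1) dx = x powr r / r\<close>; it adds up the truncation biases.
Concavity of \<open>x powr r\<close>, in the form of Bernoulli's inequality, gives each step.\<close>

lemma sum_powr_le:
  fixes r :: real
  assumes "0 < r" "r \<le> 1"
  shows "(\<Sum>i=1..n. real i powr (r - 1)) \<le> real n powr r / r"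
proof (induction n)
  case (Suc n)
  let ?k = "real (Suc n)"
  have step: "?k powr (r - 1) \<le> ?k powr r / r - real n powr r / r"
  proof (cases "n = 0")
    case True then show ?thesis using assms by simp
  next
    case False
    define x where "x = real n / ?k"
    have x: "0 < x" using False by (simp add: x_def)
    \<comment> \<open>Bernoulli's inequality for the exponent \<open>r \<le> 1\<close>, from convexity of the exponential.\<close>
    have "x powr r = exp ((1 - r) * 0 + r * ln x)" using x by (simp add: powr_def)
    also have "\<dots> \<le> (1 - r) * exp 0 + r * exp (ln x)"
      using convex_onD[OF exp_convex, of r 0 "ln x"] assms by simp
    also have "\<dots> = 1 - r / ?k" using x by (simp add: x_def field_simps)
    finally have "real n powr r \<le> ?k powr r * (1 - r / ?k)"
      by (simp add: x_def powr_divide field_simps)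
    also have "\<dots> = ?k powr r - r * ?k powr (r - 1)"
      by (simp add: powr_diff field_simps)
    finally show ?thesis using assms by (simp add: field_simps)
  qed
  then show ?case using Suc by (simp add: diff_divide_distrib)
qed simp

section \<open>The Gaussian mixture as a betting score\<close>

definition mixture_evalue :: "real \<Rightarrow> real \<Rightarrow> real \<Rightarrow> real" where
  "mixture_evalue \<rho> S V = exp (\<rho> * S\<^sup>2 / (2 * (\<rho> * V + 1))) / sqrt (\<rho> * V + 1)"

lemma mixture_evalue_nonneg: "0 \<le> \<rho> \<Longrightarrow> 0 \<le> V \<Longrightarrow> 0 \<le> mixture_evalue \<rho> S V"
  by (simp add: mixture_evalue_def)

lemma mixture_evalue_antimono:
  assumes "0 < \<rho>" "0 \<le> V" "V \<le> V'"
  shows "mixture_evalue \<rho> S V' \<le> mixture_evalue \<rho> S V"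
  unfolding mixture_evalue_def using assms
  by (intro frac_le divide_left_mono iffD2[OF exp_le_cancel_iff] real_sqrt_le_mono)
     (auto intro!: mult_pos_pos add_nonneg_pos mult_left_mono)

text \<open>The coefficient of \<open>S\<^sup>2\<close> in the exponent is at most \<open>1/(2V)\<close>, whatever \<open>\<rho>\<close> is. A bias \<open>D\<close>
is thus harmless once \<open>\<bar>S\<bar> \<bar>D\<bar>\<close> is small compared with \<open>V\<close>.\<close>

lemma mixture_evalue_shift:
  assumes "0 < \<rho>" "0 < V"
  shows "mixture_evalue \<rho> (S + D) V \<le> exp ((2 * \<bar>S\<bar> * \<bar>D\<bar> + D\<^sup>2) / (2 * V)) * mixture_evalue \<rho> S V"
proof -
  have pos: "0 < \<rho> * V + 1" using assms by (simp add: add_pos_pos)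
  have "\<rho> * (S + D)\<^sup>2 / (2 * (\<rho> * V + 1)) =
      \<rho> * (2 * S * D + D\<^sup>2) / (2 * (\<rho> * V + 1)) + \<rho> * S\<^sup>2 / (2 * (\<rho> * V + 1))"
    by (simp add: add_divide_distrib[symmetric] power2_eq_square algebra_simps)
  also have "\<rho> * (2 * S * D + D\<^sup>2) / (2 * (\<rho> * V + 1)) \<le> \<rho> * (2 * \<bar>S\<bar> * \<bar>D\<bar> + D\<^sup>2) / (2 * (\<rho> * V + 1))"
  proof -
    have "S * D \<le> \<bar>S\<bar> * \<bar>D\<bar>" by (metis abs_ge_self abs_mult)
    then show ?thesis using assms pos by (intro divide_right_mono mult_left_mono) auto
  qed
  also have "\<dots> \<le> \<rho> * (2 * \<bar>S\<bar> * \<bar>D\<bar> + D\<^sup>2) / (2 * (\<rho> * V))"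
    using assms by (intro divide_left_mono) (auto intro!: mult_pos_pos add_pos_pos)
  also have "\<dots> = (2 * \<bar>S\<bar> * \<bar>D\<bar> + D\<^sup>2) / (2 * V)" using assms by simp
  finally have "\<rho> * (S + D)\<^sup>2 / (2 * (\<rho> * V + 1))
      \<le> (2 * \<bar>S\<bar> * \<bar>D\<bar> + D\<^sup>2) / (2 * V) + \<rho> * S\<^sup>2 / (2 * (\<rho> * V + 1))" by simp
  then show ?thesis unfolding mixture_evalue_def
    using pos by (simp add: divide_right_mono exp_add[symmetric])
qed

text \<open>Completing the square: as a function of \<open>l\<close> the integrand is a multiple of a normal density with
variance \<open>\<rho> / (\<rho> V + 1)\<close> and mean \<open>S\<close> times that variance.\<close>

lemma mixture_evalue_density:
  assumes "0 < \<rho>" "0 \<le> V"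
  shows "normal_density 0 (sqrt \<rho>) l * exp (l * S - l\<^sup>2 * V / 2) =
    mixture_evalue \<rho> S V * normal_density (\<rho> * S / (\<rho> * V + 1)) (sqrt (\<rho> / (\<rho> * V + 1))) l"
proof -
  define w where "w = \<rho> * V + 1"
  have w: "0 < w" using assms by (simp add: w_def add_nonneg_pos)
  have V: "V = (w - 1) / \<rho>" using assms by (simp add: w_def)
  have e: "- l\<^sup>2 / (2 * \<rho>) + (l * S - l\<^sup>2 * V / 2) =
     \<rho> * S\<^sup>2 / (2 * w) + - (l - \<rho> * S / w)\<^sup>2 / (2 * (\<rho> / w))"
    unfolding V using w assms by (simp add: field_simps power2_eq_square)
  have s: "1 / sqrt (2 * pi * \<rho>) = 1 / sqrt w * (1 / sqrt (2 * pi * (\<rho> / w)))"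
    using w assms by (simp add: real_sqrt_mult real_sqrt_divide)
  have "normal_density 0 (sqrt \<rho>) l * exp (l * S - l\<^sup>2 * V / 2) =
     1 / sqrt (2 * pi * \<rho>) * exp (- l\<^sup>2 / (2 * \<rho>) + (l * S - l\<^sup>2 * V / 2))"
    using assms unfolding exp_add by (simp add: normal_density_def)
  also have "\<dots> = (exp (\<rho> * S\<^sup>2 / (2 * w)) / sqrt w) *
     (1 / sqrt (2 * pi * (\<rho> / w)) * exp (- (l - \<rho> * S / w)\<^sup>2 / (2 * (\<rho> / w))))"
    unfolding e s exp_add by simp
  also have "\<dots> = mixture_evalue \<rho> S V * normal_density (\<rho> * S / w) (sqrt (\<rho> / w)) l"
    using w assms by (simp add: mixture_evalue_def normal_density_def w_def)
  finally show ?thesis by (simp add: w_def)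
qed

lemma nn_integral_normal_density:
  "0 < \<sigma> \<Longrightarrow> (\<integral>\<^sup>+x. ennreal (normal_density \<mu> \<sigma> x) \<partial>lborel) = 1"
  by (simp add: nn_integral_eq_integral)

lemma nn_integral_mixture:
  assumes "0 < \<rho>" "0 \<le> V"
  shows "(\<integral>\<^sup>+l. ennreal (normal_density 0 (sqrt \<rho>) l * exp (l * S - l\<^sup>2 * V / 2)) \<partial>lborel)
    = ennreal (mixture_evalue \<rho> S V)"
proof -
  have "0 < \<rho> * V + 1" using assms by (simp add: add_nonneg_pos)
  then have "0 < sqrt (\<rho> / (\<rho> * V + 1))" using assms by simp
  then show ?thesis
    unfolding mixture_evalue_density[OF assms]
    using assms by (simp add: ennreal_mult mixture_evalue_nonneg nn_integral_cmult nn_integral_normal_density)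
qed

text \<open>The integrand concentrates around \<open>l = S/V\<close>, at most \<open>c/4\<close> in absolute value; beyond \<open>c\<close> the
quadratic term wins and the integrand is at most \<open>exp (- c\<^sup>2 V / 4)\<close> times the prior density.\<close>

lemma mixture_evalue_le_truncated:
  assumes "0 < \<rho>" "0 \<le> V" "0 \<le> c" "\<bar>S\<bar> \<le> c * V / 4"
  shows "ennreal (mixture_evalue \<rho> S V) \<le>
    (\<integral>\<^sup>+l. ennreal (normal_density 0 (sqrt \<rho>) l * exp (l * S - l\<^sup>2 * V / 2)) * indicator {-c..c} l \<partial>lborel)
      + ennreal (exp (- (c\<^sup>2 * V / 4)))"
proof -
  have tail: "exp (l * S - l\<^sup>2 * V / 2) \<le> exp (- (c\<^sup>2 * V / 4))" if "c < \<bar>l\<bar>" for l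
  proof -
    have "l * S \<le> \<bar>l\<bar> * (c * V / 4)"
      using mult_left_mono[OF assms(4), of "\<bar>l\<bar>"] abs_ge_self[of "l * S"] by (simp add: abs_mult)
    also have "\<dots> \<le> \<bar>l\<bar> * (\<bar>l\<bar> * V / 4)" using that assms by (intro mult_left_mono divide_right_mono mult_right_mono) auto
    also have "\<dots> = l\<^sup>2 * V / 4" by (simp add: power2_eq_square)
    finally have "l * S - l\<^sup>2 * V / 2 \<le> - (l\<^sup>2 * V / 4)" by simp
    moreover have "c\<^sup>2 \<le> l\<^sup>2" using that assms by (simp add: abs_le_square_iff[symmetric])
    ultimately show ?thesis using mult_right_mono[of "c\<^sup>2" "l\<^sup>2" V] assms by simp
  qed
  have "ennreal (mixture_evalue \<rho> S V) =
      (\<integral>\<^sup>+l. ennreal (normal_density 0 (sqrt \<rho>) l * exp (l * S - l\<^sup>2 * V / 2)) \<partial>lborel)"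
    using nn_integral_mixture[OF assms(1,2)] by simp
  also have "\<dots> \<le> (\<integral>\<^sup>+l. ennreal (normal_density 0 (sqrt \<rho>) l * exp (l * S - l\<^sup>2 * V / 2)) * indicator {-c..c} l
      + ennreal (exp (- (c\<^sup>2 * V / 4))) * ennreal (normal_density 0 (sqrt \<rho>) l) \<partial>lborel)"
  proof (rule nn_integral_mono)
    fix l
    show "ennreal (normal_density 0 (sqrt \<rho>) l * exp (l * S - l\<^sup>2 * V / 2)) \<le>
      ennreal (normal_density 0 (sqrt \<rho>) l * exp (l * S - l\<^sup>2 * V / 2)) * indicator {-c..c} l
      + ennreal (exp (- (c\<^sup>2 * V / 4))) * ennreal (normal_density 0 (sqrt \<rho>) l)"
    proof (cases "\<bar>l\<bar> \<le> c")
      case True then show ?thesis by (auto simp: indicator_def)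
    next
      case False
      then have "normal_density 0 (sqrt \<rho>) l * exp (l * S - l\<^sup>2 * V / 2) \<le>
          normal_density 0 (sqrt \<rho>) l * exp (- (c\<^sup>2 * V / 4))"
        by (intro mult_left_mono tail) auto
      then show ?thesis using False
        by (auto simp: indicator_def ennreal_mult[symmetric] mult.commute intro!: ennreal_leI)
    qed
  qed
  also have "\<dots> = (\<integral>\<^sup>+l. ennreal (normal_density 0 (sqrt \<rho>) l * exp (l * S - l\<^sup>2 * V / 2)) * indicator {-c..c} l \<partial>lborel)
      + ennreal (exp (- (c\<^sup>2 * V / 4)))"
    using assms by (subst nn_integral_add) (auto simp: nn_integral_cmult nn_integral_normal_density)
  finally show ?thesis .
qed

section \<open>Missing the mean forces a large betting score\<close>

definition centred_sum :: "(nat \<Rightarrow> 'w \<Rightarrow> real) \<Rightarrow> real \<Rightarrow> nat \<Rightarrow> 'w \<Rightarrow> real" where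
  "centred_sum X \<mu> k \<omega> = (\<Sum>i=1..k. X i \<omega> - \<mu>)"

lemma sample_mean_centred:
  "1 \<le> k \<Longrightarrow> sample_mean X k \<omega> = \<mu> + centred_sum X \<mu> k \<omega> / real k"
  by (simp add: sample_mean_def centred_sum_def sum_subtractf field_simps)

lemma sample_var_centred:
  assumes "1 \<le> k"
  shows "sample_var X k \<omega> = (\<Sum>i=1..k. (X i \<omega> - \<mu>)\<^sup>2) / real k - (centred_sum X \<mu> k \<omega> / real k)\<^sup>2"
proof -
  define S where "S = centred_sum X \<mu> k \<omega>"
  have "(\<Sum>i=1..k. (X i \<omega> - sample_mean X k \<omega>)\<^sup>2)
     = (\<Sum>i=1..k. (X i \<omega> - \<mu>)\<^sup>2 - 2 * (S / k) * (X i \<omega> - \<mu>) + (S / k)\<^sup>2)"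
    unfolding sample_mean_centred[OF assms, of X \<omega> \<mu>] S_def[symmetric]
    by (intro sum.cong) (auto simp: power2_eq_square field_simps)
  also have "\<dots> = (\<Sum>i=1..k. (X i \<omega> - \<mu>)\<^sup>2) - 2 * (S / k) * S + k * (S / k)\<^sup>2"
  proof -
    have "(\<Sum>i=1..k. 2 * (S / k) * (X i \<omega> - \<mu>)) = 2 * (S / k) * S"
      by (simp only: sum_distrib_left[symmetric] S_def centred_sum_def)
    moreover have "(\<Sum>i=1..k. (S / k)\<^sup>2) = k * (S / k)\<^sup>2" by simp
    ultimately show ?thesis by (simp only: sum.distrib sum_subtractf)
  qed
  also have "\<dots> = (\<Sum>i=1..k. (X i \<omega> - \<mu>)\<^sup>2) - real k * (S / k)\<^sup>2"
    using assms by (simp add: power2_eq_square field_simps)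
  finally show ?thesis using assms by (simp add: sample_var_def S_def diff_divide_distrib)
qed

text \<open>If the logarithm in the half-width is positive, squaring \<open>half_width \<le> \<bar>S/k\<bar>\<close> and solving for
\<open>\<alpha>\<close> gives the claim. If it is negative or zero, the interval is empty, but then \<open>1/\<alpha>\<close> is at most
\<open>1 / sqrt (\<rho> u + 1)\<close>, the value of the score at \<open>S = 0\<close>.\<close>

lemma miscoverage_imp_evalue:
  assumes "0 < \<rho>" "1 \<le> k" "0 \<le> u_hat X m k \<omega>" "0 < \<alpha>"
    and "\<mu> \<notin> conf_interval X \<rho> m k \<alpha> \<omega>"
  shows "1 / \<alpha> \<le> mixture_evalue \<rho> (centred_sum X \<mu> k \<omega>) (u_hat X m k \<omega>)"
proof -
  define S where "S = centred_sum X \<mu> k \<omega>"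
  define w where "w = \<rho> * u_hat X m k \<omega> + 1"
  define h where "h = half_width X \<rho> m k \<alpha> \<omega>"
  have w: "0 < w" using assms by (simp add: w_def add_nonneg_pos)
  have k: "0 < real k" using assms by simp
  have h: "h = sqrt (2 * w / ((real k)\<^sup>2 * \<rho>) * ln (sqrt w / \<alpha>))"
    by (simp add: h_def half_width_def w_def algebra_simps)
  have "\<not> (\<mu> + S / k - h < \<mu> \<and> \<mu> < \<mu> + S / k + h)"
    using assms(5) unfolding conf_interval_def sample_mean_centred[OF assms(2), of X \<omega> \<mu>] S_def h_def
    by simp
  then have hS: "h \<le> \<bar>S / k\<bar>" by linarith
  have "ln (sqrt w / \<alpha>) \<le> \<rho> * S\<^sup>2 / (2 * w)"
  proof (cases "ln (sqrt w / \<alpha>) \<le> 0")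
    case True
    also have "0 \<le> \<rho> * S\<^sup>2 / (2 * w)" using w assms by simp
    finally show ?thesis .
  next
    case False
    then have "0 \<le> 2 * w / ((real k)\<^sup>2 * \<rho>) * ln (sqrt w / \<alpha>)" using w assms by simp
    moreover from this have "0 \<le> h" unfolding h by simp
    moreover have "h\<^sup>2 \<le> \<bar>S / k\<bar>\<^sup>2" using hS \<open>0 \<le> h\<close> by (rule power_mono)
    ultimately have "2 * w / ((real k)\<^sup>2 * \<rho>) * ln (sqrt w / \<alpha>) \<le> S\<^sup>2 / (real k)\<^sup>2"
      unfolding h by (simp add: power_divide)
    then show ?thesis using k w assms by (simp add: field_simps)
  qed
  then have "exp (ln (sqrt w / \<alpha>)) \<le> exp (\<rho> * S\<^sup>2 / (2 * w))" by simp
  then have "sqrt w / \<alpha> \<le> exp (\<rho> * S\<^sup>2 / (2 * w))" using w assms by simp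
  moreover have "mixture_evalue \<rho> S (u_hat X m k \<omega>) = exp (\<rho> * S\<^sup>2 / (2 * w)) / sqrt w"
    by (simp only: mixture_evalue_def w_def)
  moreover have "1 / \<alpha> \<le> exp (\<rho> * S\<^sup>2 / (2 * w)) / sqrt w"
    using calculation(1) w assms(4) by (simp add: field_simps)
  ultimately show ?thesis by (simp add: S_def)
qed

lemma SUP_miscoverage_le:
  assumes "0 < \<rho>" "1 \<le> k" "0 \<le> u_hat X m k \<omega>" "0 < r"
  shows "(SUP \<alpha>\<in>{r<..}. ennreal (of_bool (\<mu> \<notin> conf_interval X \<rho> m k \<alpha> \<omega>) / \<alpha>))
    \<le> ennreal (mixture_evalue \<rho> (centred_sum X \<mu> k \<omega>) (u_hat X m k \<omega>))"
proof (rule SUP_least)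
  fix \<alpha> assume "\<alpha> \<in> {r<..}"
  then have "0 < \<alpha>" using assms by auto
  then show "ennreal (of_bool (\<mu> \<notin> conf_interval X \<rho> m k \<alpha> \<omega>) / \<alpha>)
    \<le> ennreal (mixture_evalue \<rho> (centred_sum X \<mu> k \<omega>) (u_hat X m k \<omega>))"
    using miscoverage_imp_evalue[OF assms(1-3), of \<alpha> \<mu>] mixture_evalue_nonneg[of \<rho> "u_hat X m k \<omega>"] assms
    by (cases "\<mu> \<in> conf_interval X \<rho> m k \<alpha> \<omega>") (auto intro!: ennreal_leI)
qed

lemma SUP_miscoverage_le_crude:
  fixes H :: "real \<Rightarrow> real set"
  assumes "0 < r"
  shows "(SUP \<alpha>\<in>{r<..}. ennreal (of_bool (\<mu> \<notin> H \<alpha>) / \<alpha>)) \<le> ennreal (1 / r)"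
  using assms by (intro SUP_least ennreal_leI) (auto simp: field_simps)

section \<open>Optional stopping for nonnegative supermartingales\<close>

text \<open>Splitting according to the value of \<open>\<tau>\<close>, each step moves the mass of \<open>{\<tau> > n}\<close> forward without
increasing it, so the partial sums over \<open>{\<tau> \<le> n}\<close> never exceed the initial expectation. As \<open>\<tau>\<close> is
finite everywhere, these sums converge to the expectation at time \<open>\<tau>\<close>.\<close>

lemma nn_integral_stopped_le:
  fixes N :: "nat \<Rightarrow> 'w \<Rightarrow> ennreal"
  assumes F_sub: "\<And>n. sets (F n) \<subseteq> sets M" and F_space: "\<And>n. space (F n) = space M"
    and N[measurable]: "\<And>n. N n \<in> borel_measurable M"
    and step: "\<And>n A. A \<in> sets (F n) \<Longrightarrow>
      (\<integral>\<^sup>+\<omega>. N (Suc n) \<omega> * indicator A \<omega> \<partial>M) \<le> (\<integral>\<^sup>+\<omega>. N n \<omega> * indicator A \<omega> \<partial>M)"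
    and \<tau>: "stopping_time F \<tau>"
  shows "(\<integral>\<^sup>+\<omega>. N (\<tau> \<omega>) \<omega> \<partial>M) \<le> (\<integral>\<^sup>+\<omega>. N 0 \<omega> \<partial>M)"
proof -
  define E where "E n = {\<omega>\<in>space M. \<tau> \<omega> = n}" for n
  define G where "G n = {\<omega>\<in>space M. n < \<tau> \<omega>}" for n
  have le_F: "{\<omega>\<in>space M. \<tau> \<omega> \<le> n} \<in> sets (F n)" for n
    using stopping_timeD[OF \<tau>, of n] unfolding pred_def F_space .
  have G_F: "G n \<in> sets (F n)" for n
  proof -
    have "G n = space (F n) - {\<omega>\<in>space M. \<tau> \<omega> \<le> n}" unfolding G_def F_space by auto
    then show ?thesis using le_F by auto
  qed
  have [measurable]: "G n \<in> sets M" for n using G_F F_sub by blast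
  have [measurable]: "E n \<in> sets M" for n
  proof -
    have "E n = (space M - G n) \<inter> (if n = 0 then space M else G (n - 1))"
      unfolding E_def G_def by auto
    then show ?thesis by simp
  qed
  have partial: "(\<Sum>j\<le>n. \<integral>\<^sup>+\<omega>. N j \<omega> * indicator (E j) \<omega> \<partial>M) + (\<integral>\<^sup>+\<omega>. N n \<omega> * indicator (G n) \<omega> \<partial>M)
      \<le> (\<integral>\<^sup>+\<omega>. N 0 \<omega> \<partial>M)" for n
  proof (induction n)
    case 0
    have "(\<integral>\<^sup>+\<omega>. N 0 \<omega> * indicator (E 0) \<omega> \<partial>M) + (\<integral>\<^sup>+\<omega>. N 0 \<omega> * indicator (G 0) \<omega> \<partial>M)
      = (\<integral>\<^sup>+\<omega>. N 0 \<omega> * indicator (E 0) \<omega> + N 0 \<omega> * indicator (G 0) \<omega> \<partial>M)"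
      by (rule nn_integral_add[symmetric]) auto
    also have "\<dots> = (\<integral>\<^sup>+\<omega>. N 0 \<omega> \<partial>M)"
      by (intro nn_integral_cong) (auto simp: E_def G_def indicator_def)
    finally show ?case by simp
  next
    case (Suc n)
    have "(\<integral>\<^sup>+\<omega>. N (Suc n) \<omega> * indicator (E (Suc n)) \<omega> \<partial>M) + (\<integral>\<^sup>+\<omega>. N (Suc n) \<omega> * indicator (G (Suc n)) \<omega> \<partial>M)
      = (\<integral>\<^sup>+\<omega>. N (Suc n) \<omega> * indicator (E (Suc n)) \<omega> + N (Suc n) \<omega> * indicator (G (Suc n)) \<omega> \<partial>M)"
      by (rule nn_integral_add[symmetric]) auto
    also have "\<dots> = (\<integral>\<^sup>+\<omega>. N (Suc n) \<omega> * indicator (G n) \<omega> \<partial>M)"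
      by (intro nn_integral_cong) (auto simp: E_def G_def indicator_def)
    also have "\<dots> \<le> (\<integral>\<^sup>+\<omega>. N n \<omega> * indicator (G n) \<omega> \<partial>M)" by (rule step[OF G_F])
    finally have "(\<Sum>j\<le>n. \<integral>\<^sup>+\<omega>. N j \<omega> * indicator (E j) \<omega> \<partial>M) +
        ((\<integral>\<^sup>+\<omega>. N (Suc n) \<omega> * indicator (E (Suc n)) \<omega> \<partial>M) + (\<integral>\<^sup>+\<omega>. N (Suc n) \<omega> * indicator (G (Suc n)) \<omega> \<partial>M))
      \<le> (\<Sum>j\<le>n. \<integral>\<^sup>+\<omega>. N j \<omega> * indicator (E j) \<omega> \<partial>M) + (\<integral>\<^sup>+\<omega>. N n \<omega> * indicator (G n) \<omega> \<partial>M)"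
      by (rule add_left_mono)
    also note Suc
    finally show ?case by (simp add: add.assoc)
  qed
  have "(\<integral>\<^sup>+\<omega>. N (\<tau> \<omega>) \<omega> \<partial>M) = (\<integral>\<^sup>+\<omega>. (\<Sum>j. N j \<omega> * indicator (E j) \<omega>) \<partial>M)"
  proof (rule nn_integral_cong)
    fix \<omega> assume "\<omega> \<in> space M"
    then have "(\<Sum>j. N j \<omega> * indicator (E j) \<omega>) = (\<Sum>j\<in>{\<tau> \<omega>}. N j \<omega> * indicator (E j) \<omega>)"
      by (intro suminf_finite) (auto simp: E_def)
    then show "N (\<tau> \<omega>) \<omega> = (\<Sum>j. N j \<omega> * indicator (E j) \<omega>)"
      using \<open>\<omega> \<in> space M\<close> by (simp add: E_def)
  qed
  also have "\<dots> = (\<Sum>j. \<integral>\<^sup>+\<omega>. N j \<omega> * indicator (E j) \<omega> \<partial>M)"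
    by (rule nn_integral_suminf) auto
  also have "\<dots> \<le> (\<integral>\<^sup>+\<omega>. N 0 \<omega> \<partial>M)"
  proof (rule suminf_le_const)
    fix n
    have "(\<Sum>j<n. \<integral>\<^sup>+\<omega>. N j \<omega> * indicator (E j) \<omega> \<partial>M) \<le> (\<Sum>j\<le>n. \<integral>\<^sup>+\<omega>. N j \<omega> * indicator (E j) \<omega> \<partial>M)"
      by (intro sum_mono2) auto
    also have "\<dots> \<le> (\<integral>\<^sup>+\<omega>. N 0 \<omega> \<partial>M)"
      using partial[of n] by (meson add_increasing2 dual_order.trans order_refl zero_le)
    finally show "(\<Sum>j<n. \<integral>\<^sup>+\<omega>. N j \<omega> * indicator (E j) \<omega> \<partial>M) \<le> (\<integral>\<^sup>+\<omega>. N 0 \<omega> \<partial>M)" .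
  qed auto
  finally show ?thesis .
qed

lemma stopping_time_natural_filtration_measurable:
  fixes \<tau> :: "'w \<Rightarrow> nat"
  assumes "\<And>n. sets (F n) \<subseteq> sets M" "\<And>n. space (F n) = space M" "stopping_time F \<tau>"
  shows "\<tau> \<in> measurable M (count_space UNIV)"
  using measurable_stopping_time[OF assms(3,1,2)] by (simp add: measurable_cong_sets[OF refl sets_borel_eq_count_space])

section \<open>Independence of the next observation from the past\<close>

lemma space_natural_filtration [simp]: "space (natural_filtration M X n) = space M"
  unfolding natural_filtration_def by (rule space_measure_of) auto

lemma sets_natural_filtration:
  "sets (natural_filtration M X n) =
    sigma_sets (space M) {X i -` B \<inter> space M | i B. i \<in> {1..n} \<and> B \<in> sets borel}"
  unfolding natural_filtration_def by (rule sets_measure_of) auto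

lemma measurable_natural_filtration:
  "1 \<le> i \<Longrightarrow> i \<le> n \<Longrightarrow> X i \<in> borel_measurable (natural_filtration M X n)"
  by (rule measurableI) (auto simp: sets_natural_filtration intro!: sigma_sets.Basic)

locale independent_sequence = prob_space M for M :: "'w measure" +
  fixes X :: "nat \<Rightarrow> 'w \<Rightarrow> real"
  assumes indep: "indep_vars (\<lambda>_. borel) X {1..}"
begin

abbreviation F :: "nat \<Rightarrow> 'w measure" where "F \<equiv> natural_filtration M X"

lemma X_measurable: "1 \<le> i \<Longrightarrow> X i \<in> borel_measurable M"
  using indep by (auto simp: indep_vars_def)

lemma sets_F_subset: "sets (F n) \<subseteq> sets M"
  unfolding sets_natural_filtration
  by (rule sets.sigma_sets_subset) (auto intro!: measurable_sets[OF X_measurable])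

text \<open>The index sets \<open>{1..n}\<close> and \<open>{n + 1}\<close> are disjoint, so the generated \<open>\<sigma>\<close>-algebras are independent.\<close>

lemma indep_past_next:
  "indep_set (sets (F n)) (sigma_sets (space M) {X (Suc n) -` A \<inter> space M | A. A \<in> sets borel})"
proof -
  let ?E = "\<lambda>i. {X i -` A \<inter> space M | A. A \<in> sets borel}"
  let ?I = "\<lambda>b. if b then {1..n} else {Suc n}"
  have "indep_sets ?E {1..}" using indep by (simp add: indep_vars_def2)
  then have "indep_sets ?E (\<Union>b\<in>UNIV. ?I b)" by (rule indep_sets_mono_index[rotated]) (auto split: if_splits)
  then have "indep_sets (\<lambda>b. sigma_sets (space M) (\<Union>i\<in>?I b. ?E i)) UNIV"
  proof (rule indep_sets_collect_sigma)
    show "Int_stable (?E i)" for i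
    proof (safe intro!: Int_stableI)
      fix A B :: "real set" assume "A \<in> sets borel" "B \<in> sets borel"
      then show "\<exists>C. X i -` A \<inter> space M \<inter> (X i -` B \<inter> space M) = X i -` C \<inter> space M \<and> C \<in> sets borel"
        by (intro exI[of _ "A \<inter> B"]) auto
    qed
    show "disjoint_family_on ?I UNIV" by (auto simp: disjoint_family_on_def)
  qed
  moreover have "(\<lambda>b. sigma_sets (space M) (\<Union>i\<in>?I b. ?E i)) =
     case_bool (sets (F n)) (sigma_sets (space M) (?E (Suc n)))"
  proof (rule ext)
    fix b
    have "(\<Union>i\<in>{1..n}. ?E i) = {X i -` B \<inter> space M | i B. i \<in> {1..n} \<and> B \<in> sets borel}" by blast
    then show "sigma_sets (space M) (\<Union>i\<in>?I b. ?E i) =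
       case_bool (sets (F n)) (sigma_sets (space M) (?E (Suc n))) b"
      by (cases b) (simp_all add: sets_natural_filtration)
  qed
  ultimately show ?thesis unfolding indep_set_def by simp
qed

lemma nn_integral_past_times_next:
  assumes h: "h \<in> borel_measurable (F n)" "\<And>\<omega>. 0 \<le> h \<omega>"
    and g: "g \<in> borel_measurable borel" "\<And>x. 0 \<le> g x"
  shows "(\<integral>\<^sup>+\<omega>. ennreal (h \<omega> * g (X (Suc n) \<omega>)) \<partial>M) =
    (\<integral>\<^sup>+\<omega>. ennreal (h \<omega>) \<partial>M) * (\<integral>\<^sup>+\<omega>. ennreal (g (X (Suc n) \<omega>)) \<partial>M)"
proof -
  let ?N = "sigma_sets (space M) {X (Suc n) -` A \<inter> space M | A. A \<in> sets borel}"
  have past: "sigma_sets (space M) {h -` A \<inter> space M | A. A \<in> sets borel} \<subseteq> sets (F n)"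
    using measurable_sets[OF h(1)] sets.sigma_sets_subset[of "{h -` A \<inter> space M | A. A \<in> sets borel}" "F n"]
    by auto
  have "(\<lambda>\<omega>. g (X (Suc n) \<omega>)) -` A \<inter> space M = X (Suc n) -` (g -` A) \<inter> space M" for A by auto
  moreover have "g -` A \<in> sets borel" if "A \<in> sets borel" for A
    using measurable_sets[OF g(1) that] by simp
  ultimately have next_step: "sigma_sets (space M) {(\<lambda>\<omega>. g (X (Suc n) \<omega>)) -` A \<inter> space M | A. A \<in> sets borel} \<subseteq> ?N"
    by (intro sigma_sets_mono') blast
  have "random_variable borel h"
    using h(1) measurable_mono[OF order_refl refl sets_F_subset[of n] space_natural_filtration] by blast
  moreover have "random_variable borel (\<lambda>\<omega>. g (X (Suc n) \<omega>))"
    using X_measurable[of "Suc n"] g(1) by simp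
  ultimately have "indep_var borel h borel (\<lambda>\<omega>. g (X (Suc n) \<omega>))"
    unfolding indep_var_eq using indep_past_next[of n] past next_step
    unfolding indep_sets2_eq by blast
  then have "indep_vars (case_bool borel borel) (case_bool h (\<lambda>\<omega>. g (X (Suc n) \<omega>))) UNIV"
    by (simp add: indep_var_def)
  moreover have "case_bool borel borel = (\<lambda>_. borel :: real measure)" by (auto split: bool.split)
  ultimately have "indep_vars (\<lambda>_. borel) (case_bool h (\<lambda>\<omega>. g (X (Suc n) \<omega>))) UNIV" by simp
  then have "indep_vars (\<lambda>_. borel) (\<lambda>b \<omega>. ennreal (case_bool h (\<lambda>\<omega>. g (X (Suc n) \<omega>)) b \<omega>)) UNIV"
    by (rule indep_vars_compose2) auto
  from indep_vars_nn_integral[OF finite this] show ?thesis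
    using h(2) g(2) by (simp add: UNIV_bool ennreal_mult mult.commute split: bool.split)
qed

end

section \<open>Mixtures of exponential supermartingales\<close>

text \<open>Increments \<open>g i (X i)\<close> that are sub-Gaussian with variance proxy \<open>s\<close> only for exponents
\<open>\<bar>l\<bar> \<le> c i\<close>. The range decreases with \<open>i\<close>, because truncation levels grow.\<close>

locale subgaussian_steps = independent_sequence M X
  for M :: "'w measure" and X :: "nat \<Rightarrow> 'w \<Rightarrow> real" +
  fixes g :: "nat \<Rightarrow> real \<Rightarrow> real" and s :: real and c :: "nat \<Rightarrow> real"
  assumes g_measurable: "\<And>i. g i \<in> borel_measurable borel"
    and c_antimono: "antimono c"
    and subgaussian: "\<And>i l. 1 \<le> i \<Longrightarrow> \<bar>l\<bar> \<le> c i \<Longrightarrow>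
      (\<integral>\<^sup>+\<omega>. ennreal (exp (l * g i (X i \<omega>))) \<partial>M) \<le> ennreal (exp (l\<^sup>2 * s / 2))"
begin

definition W :: "nat \<Rightarrow> 'w \<Rightarrow> real" where
  "W n \<omega> = (\<Sum>i=1..n. g i (X i \<omega>))"

definition L :: "real \<Rightarrow> nat \<Rightarrow> 'w \<Rightarrow> real" where
  "L l n \<omega> = exp (l * W n \<omega> - l\<^sup>2 * (real n * s) / 2)"

lemma W_measurable_F: "W n \<in> borel_measurable (F n)"
  unfolding W_def
  by (intro borel_measurable_sum measurable_compose[OF _ g_measurable] measurable_natural_filtration) auto

lemma W_measurable [measurable]: "W n \<in> borel_measurable M"
  using W_measurable_F[of n] by (rule measurable_mono[OF order_refl _ sets_F_subset, THEN subsetD, rotated 2]) simp_all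

lemma L_step:
  assumes "\<bar>l\<bar> \<le> c (Suc n)" "A \<in> sets (F n)"
  shows "(\<integral>\<^sup>+\<omega>. ennreal (L l (Suc n) \<omega>) * indicator A \<omega> \<partial>M) \<le> (\<integral>\<^sup>+\<omega>. ennreal (L l n \<omega>) * indicator A \<omega> \<partial>M)"
proof -
  have [measurable]: "W n \<in> borel_measurable (F n)" "A \<in> sets (F n)" "A \<in> sets M"
    using assms W_measurable_F sets_F_subset by auto
  let ?h = "\<lambda>\<omega>. L l n \<omega> * exp (- l\<^sup>2 * s / 2) * indicator A \<omega>"
  have "(\<integral>\<^sup>+\<omega>. ennreal (L l (Suc n) \<omega>) * indicator A \<omega> \<partial>M)
     = (\<integral>\<^sup>+\<omega>. ennreal (?h \<omega> * exp (l * g (Suc n) (X (Suc n) \<omega>))) \<partial>M)"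
  proof (rule nn_integral_cong)
    fix \<omega>
    have "L l (Suc n) \<omega> = L l n \<omega> * exp (- l\<^sup>2 * s / 2) * exp (l * g (Suc n) (X (Suc n) \<omega>))"
      unfolding L_def W_def exp_add[symmetric] by (simp add: field_simps)
    then show "ennreal (L l (Suc n) \<omega>) * indicator A \<omega> =
      ennreal (?h \<omega> * exp (l * g (Suc n) (X (Suc n) \<omega>)))"
      by (auto simp: indicator_def)
  qed
  also have "\<dots> = (\<integral>\<^sup>+\<omega>. ennreal (?h \<omega>) \<partial>M) * (\<integral>\<^sup>+\<omega>. ennreal (exp (l * g (Suc n) (X (Suc n) \<omega>))) \<partial>M)"
    using g_measurable by (intro nn_integral_past_times_next) (auto simp: L_def)
  also have "\<dots> \<le> (\<integral>\<^sup>+\<omega>. ennreal (?h \<omega>) \<partial>M) * ennreal (exp (l\<^sup>2 * s / 2))"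
    using assms by (intro mult_left_mono subgaussian) auto
  also have "(\<integral>\<^sup>+\<omega>. ennreal (?h \<omega>) \<partial>M) =
      (\<integral>\<^sup>+\<omega>. ennreal (exp (- l\<^sup>2 * s / 2)) * (ennreal (L l n \<omega>) * indicator A \<omega>) \<partial>M)"
    by (intro nn_integral_cong) (auto simp: indicator_def L_def ennreal_mult[symmetric] mult.commute)
  also have "\<dots> = ennreal (exp (- l\<^sup>2 * s / 2)) * (\<integral>\<^sup>+\<omega>. ennreal (L l n \<omega>) * indicator A \<omega> \<partial>M)"
    unfolding L_def by (intro nn_integral_cmult) measurable
  also have "\<dots> * ennreal (exp (l\<^sup>2 * s / 2)) =
     ennreal (exp (- l\<^sup>2 * s / 2) * exp (l\<^sup>2 * s / 2)) * (\<integral>\<^sup>+\<omega>. ennreal (L l n \<omega>) * indicator A \<omega> \<partial>M)"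
    by (simp add: ennreal_mult mult_ac)
  also have "\<dots> = (\<integral>\<^sup>+\<omega>. ennreal (L l n \<omega>) * indicator A \<omega> \<partial>M)"
    by (simp add: exp_add[symmetric])
  finally show ?thesis .
qed

lemma nn_integral_L_le_1:
  "\<bar>l\<bar> \<le> c n \<Longrightarrow> (\<integral>\<^sup>+\<omega>. ennreal (L l n \<omega>) \<partial>M) \<le> 1"
proof (induction n)
  case 0
  then show ?case by (simp add: L_def W_def emeasure_space_1)
next
  case (Suc n)
  have "(\<integral>\<^sup>+\<omega>. ennreal (L l (Suc n) \<omega>) \<partial>M) = (\<integral>\<^sup>+\<omega>. ennreal (L l (Suc n) \<omega>) * indicator (space M) \<omega> \<partial>M)"
    by (intro nn_integral_cong) simp
  also have "\<dots> \<le> (\<integral>\<^sup>+\<omega>. ennreal (L l n \<omega>) * indicator (space M) \<omega> \<partial>M)"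
    using Suc sets.top[of "F n"] by (intro L_step) auto
  also have "\<dots> = (\<integral>\<^sup>+\<omega>. ennreal (L l n \<omega>) \<partial>M)"
    by (intro nn_integral_cong) simp
  also have "\<dots> \<le> 1"
    using Suc antimonoD[OF c_antimono, of n "Suc n"] by (intro Suc.IH) auto
  finally show ?case .
qed

text \<open>Chernoff's bound for both signs, with the single exponent \<open>r\<close>.\<close>

lemma prob_W_deviation:
  assumes "0 < r" "r \<le> c n"
  shows "emeasure M {\<omega>\<in>space M. t \<le> \<bar>W n \<omega>\<bar>} \<le> ennreal (2 * exp (r\<^sup>2 * (real n * s) / 2 - r * t))"
proof -
  have one: "emeasure M {\<omega>\<in>space M. t \<le> e * W n \<omega>} \<le> ennreal (exp (r\<^sup>2 * (real n * s) / 2 - r * t))"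
    if "\<bar>e\<bar> = 1" for e
  proof -
    have e2: "e\<^sup>2 = 1" using that by (metis one_power2 power2_abs)
    let ?K = "exp (r\<^sup>2 * (real n * s) / 2 - r * t)"
    have "emeasure M {\<omega>\<in>space M. t \<le> e * W n \<omega>} = (\<integral>\<^sup>+\<omega>. indicator {\<omega>\<in>space M. t \<le> e * W n \<omega>} \<omega> \<partial>M)"
      by (subst nn_integral_indicator) auto
    also have "\<dots> \<le> (\<integral>\<^sup>+\<omega>. ennreal ?K * ennreal (L (e * r) n \<omega>) \<partial>M)"
    proof (rule nn_integral_mono)
      fix \<omega>
      show "indicator {\<omega>\<in>space M. t \<le> e * W n \<omega>} \<omega> \<le> ennreal ?K * ennreal (L (e * r) n \<omega>)"
      proof (cases "t \<le> e * W n \<omega>")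
        case True
        have "?K * L (e * r) n \<omega> = exp (r * (e * W n \<omega> - t))"
          unfolding L_def exp_add[symmetric] power_mult_distrib e2 by (simp add: algebra_simps)
        also have "\<dots> \<ge> 1" using True assms by simp
        finally show ?thesis
          by (simp add: ennreal_mult[symmetric] L_def indicator_def del: ennreal_1)
      qed (simp add: indicator_def)
    qed
    also have "\<dots> = ennreal ?K * (\<integral>\<^sup>+\<omega>. ennreal (L (e * r) n \<omega>) \<partial>M)"
      unfolding L_def by (intro nn_integral_cmult) auto
    also have "\<dots> \<le> ennreal ?K * 1"
      using assms that by (intro mult_left_mono nn_integral_L_le_1) (auto simp: abs_mult)
    finally show ?thesis by simp
  qed
  have "emeasure M {\<omega>\<in>space M. t \<le> \<bar>W n \<omega>\<bar>} \<le>
      emeasure M ({\<omega>\<in>space M. t \<le> 1 * W n \<omega>} \<union> {\<omega>\<in>space M. t \<le> (-1) * W n \<omega>})"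
    by (intro emeasure_mono) auto
  also have "\<dots> \<le> emeasure M {\<omega>\<in>space M. t \<le> 1 * W n \<omega>} + emeasure M {\<omega>\<in>space M. t \<le> (-1) * W n \<omega>}"
    by (intro emeasure_subadditive) auto
  also have "\<dots> \<le> ennreal (exp (r\<^sup>2 * (real n * s) / 2 - r * t)) + ennreal (exp (r\<^sup>2 * (real n * s) / 2 - r * t))"
    by (intro add_mono one) auto
  also have "\<dots> = ennreal (2 * exp (r\<^sup>2 * (real n * s) / 2 - r * t))"
    by (simp add: ennreal_plus[symmetric] del: ennreal_plus)
  finally show ?thesis .
qed

text \<open>The range of integration is \<open>\<bar>l\<bar> \<le> c n\<close>: the part of the prior on which the exponential process is
still known to be a supermartingale at time \<open>n\<close>.\<close>

definition mixture :: "real \<Rightarrow> nat \<Rightarrow> 'w \<Rightarrow> ennreal" where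
  "mixture \<rho> n \<omega> = (\<integral>\<^sup>+l. ennreal (normal_density 0 (sqrt \<rho>) l * L l n \<omega>) * indicator {- c n..c n} l \<partial>lborel)"

lemma mixture_measurable [measurable]: "mixture \<rho> n \<in> borel_measurable M"
proof -
  have "(\<lambda>(\<omega>, l). ennreal (normal_density 0 (sqrt \<rho>) l * L l n \<omega>) * indicator {- c n..c n} l)
    \<in> borel_measurable (M \<Otimes>\<^sub>M lborel)"
    unfolding L_def by measurable
  then show ?thesis unfolding mixture_def
    by (rule lborel.borel_measurable_nn_integral)
qed

lemma nn_integral_mixture_indicator:
  assumes [measurable]: "A \<in> sets M"
  shows "(\<integral>\<^sup>+\<omega>. mixture \<rho> n \<omega> * indicator A \<omega> \<partial>M) =
    (\<integral>\<^sup>+l. ennreal (normal_density 0 (sqrt \<rho>) l) * indicator {- c n..c n} l *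
       (\<integral>\<^sup>+\<omega>. ennreal (L l n \<omega>) * indicator A \<omega> \<partial>M) \<partial>lborel)"
proof -
  interpret pair_sigma_finite M lborel ..
  let ?f = "\<lambda>\<omega> l. ennreal (normal_density 0 (sqrt \<rho>) l) * indicator {- c n..c n} l * (ennreal (L l n \<omega>) * indicator A \<omega>)"
  have f: "(\<lambda>(\<omega>, l). ?f \<omega> l) \<in> borel_measurable (M \<Otimes>\<^sub>M lborel)" unfolding L_def by measurable
  have m: "(\<lambda>l. ennreal (normal_density 0 (sqrt \<rho>) l * L l n \<omega>) * indicator {- c n..c n} l) \<in> borel_measurable lborel" for \<omega>
    unfolding L_def by measurable
  have "(\<integral>\<^sup>+\<omega>. mixture \<rho> n \<omega> * indicator A \<omega> \<partial>M) = (\<integral>\<^sup>+\<omega>. (\<integral>\<^sup>+l. ?f \<omega> l \<partial>lborel) \<partial>M)"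
    unfolding mixture_def nn_integral_multc[OF m, symmetric]
    by (intro nn_integral_cong) (auto simp: L_def ennreal_mult mult_ac)
  also have "\<dots> = (\<integral>\<^sup>+l. (\<integral>\<^sup>+\<omega>. ?f \<omega> l \<partial>M) \<partial>lborel)"
    using Fubini'[OF f] by simp
  also have "\<dots> = (\<integral>\<^sup>+l. ennreal (normal_density 0 (sqrt \<rho>) l) * indicator {- c n..c n} l *
       (\<integral>\<^sup>+\<omega>. ennreal (L l n \<omega>) * indicator A \<omega> \<partial>M) \<partial>lborel)"
    unfolding L_def by (intro nn_integral_cong nn_integral_cmult) auto
  finally show ?thesis .
qed

text \<open>For each \<open>l\<close> that survives to time \<open>n + 1\<close> the exponential process is a supermartingale; the other
\<open>l\<close> contribute 0 after the step.\<close>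

lemma mixture_step:
  assumes "A \<in> sets (F n)"
  shows "(\<integral>\<^sup>+\<omega>. mixture \<rho> (Suc n) \<omega> * indicator A \<omega> \<partial>M) \<le> (\<integral>\<^sup>+\<omega>. mixture \<rho> n \<omega> * indicator A \<omega> \<partial>M)"
proof -
  have A: "A \<in> sets M" using assms sets_F_subset by auto
  show ?thesis
    unfolding nn_integral_mixture_indicator[OF A]
  proof (rule nn_integral_mono)
    fix l :: real
    show "ennreal (normal_density 0 (sqrt \<rho>) l) * indicator {- c (Suc n)..c (Suc n)} l *
       (\<integral>\<^sup>+\<omega>. ennreal (L l (Suc n) \<omega>) * indicator A \<omega> \<partial>M) \<le>
      ennreal (normal_density 0 (sqrt \<rho>) l) * indicator {- c n..c n} l *
       (\<integral>\<^sup>+\<omega>. ennreal (L l n \<omega>) * indicator A \<omega> \<partial>M)"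
    proof (cases "\<bar>l\<bar> \<le> c (Suc n)")
      case True
      moreover have "c (Suc n) \<le> c n" by (intro antimonoD[OF c_antimono]) simp
      ultimately show ?thesis
        using L_step[OF True assms] by (auto simp: indicator_def intro!: mult_left_mono)
    qed (auto simp: indicator_def)
  qed
qed

lemma nn_integral_mixture_stopped:
  assumes "0 < \<rho>" "stopping_time F \<tau>"
  shows "(\<integral>\<^sup>+\<omega>. mixture \<rho> (\<tau> \<omega>) \<omega> \<partial>M) \<le> 1"
proof -
  have "(\<integral>\<^sup>+\<omega>. mixture \<rho> (\<tau> \<omega>) \<omega> \<partial>M) \<le> (\<integral>\<^sup>+\<omega>. mixture \<rho> 0 \<omega> \<partial>M)"
    by (rule nn_integral_stopped_le[where F=F])
       (use sets_F_subset mixture_step assms in auto)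
  also have "\<dots> \<le> (\<integral>\<^sup>+\<omega>. 1 \<partial>M)"
  proof (rule nn_integral_mono)
    fix \<omega>
    have "mixture \<rho> 0 \<omega> \<le> (\<integral>\<^sup>+l. ennreal (normal_density 0 (sqrt \<rho>) l) \<partial>lborel)"
      unfolding mixture_def by (intro nn_integral_mono) (auto simp: L_def W_def indicator_def)
    then show "mixture \<rho> 0 \<omega> \<le> 1" using assms by (simp add: nn_integral_normal_density)
  qed
  finally show ?thesis by (simp add: emeasure_space_1)
qed

end

section \<open>Truncation and moments of one observation\<close>

definition trunc :: "real \<Rightarrow> real \<Rightarrow> real" where
  "trunc b y = (if \<bar>y\<bar> \<le> b then y else 0)"

lemma trunc_measurable [measurable]: "trunc b \<in> borel_measurable borel"
  unfolding trunc_def by measurable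

lemma powr_le_one_plus_powr:
  fixes y :: real
  assumes "0 \<le> y" "0 \<le> p" "p \<le> q"
  shows "y powr p \<le> 1 + y powr q"
proof (cases "y \<le> 1")
  case True
  then have "y powr p \<le> 1" using assms by (simp add: powr_le1)
  then show ?thesis using powr_ge_zero[of y q] by linarith
next
  case False
  then have "y powr p \<le> y powr q" using assms by (intro powr_mono) auto
  then show ?thesis by linarith
qed

text \<open>A centred variable with a bounded absolute moment of order \<open>2 + \<delta>\<close>; all bounds below depend on
its law through \<open>K\<close> and the variance only.\<close>

locale moment_variable = prob_space M for M :: "'w measure" +
  fixes Y :: "'w \<Rightarrow> real" and \<delta> K :: real
  assumes \<delta>_pos: "0 < \<delta>"
    and Y_integrable: "integrable M Y" and Y_centred: "expectation Y = 0"
    and moment_integrable: "integrable M (\<lambda>\<omega>. \<bar>Y \<omega>\<bar> powr (2 + \<delta>))"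
    and moment_le: "expectation (\<lambda>\<omega>. \<bar>Y \<omega>\<bar> powr (2 + \<delta>)) \<le> K"
begin

lemma Y_measurable [measurable]: "Y \<in> borel_measurable M"
  using Y_integrable by auto

lemma K_nonneg: "0 \<le> K"
proof -
  have "0 \<le> expectation (\<lambda>\<omega>. \<bar>Y \<omega>\<bar> powr (2 + \<delta>))" by simp
  then show ?thesis using moment_le by linarith
qed

lemma lower_moment:
  assumes "0 \<le> p" "p \<le> 2 + \<delta>"
  shows "integrable M (\<lambda>\<omega>. \<bar>Y \<omega>\<bar> powr p)" "expectation (\<lambda>\<omega>. \<bar>Y \<omega>\<bar> powr p) \<le> 1 + K"
proof -
  have int: "integrable M (\<lambda>\<omega>. 1 + \<bar>Y \<omega>\<bar> powr (2 + \<delta>))" using moment_integrable by simp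
  show 1: "integrable M (\<lambda>\<omega>. \<bar>Y \<omega>\<bar> powr p)"
    by (rule Bochner_Integration.integrable_bound[OF int])
       (use powr_le_one_plus_powr[OF _ assms] in \<open>auto intro!: AE_I2\<close>)
  have "expectation (\<lambda>\<omega>. \<bar>Y \<omega>\<bar> powr p) \<le> expectation (\<lambda>\<omega>. 1 + \<bar>Y \<omega>\<bar> powr (2 + \<delta>))"
    by (rule integral_mono[OF 1 int]) (use powr_le_one_plus_powr[OF _ assms] in auto)
  also have "\<dots> \<le> 1 + K" using moment_integrable moment_le by (simp add: prob_space)
  finally show "expectation (\<lambda>\<omega>. \<bar>Y \<omega>\<bar> powr p) \<le> 1 + K" .
qed

lemma square_eq_powr: "(y::real)\<^sup>2 = \<bar>y\<bar> powr 2"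
  by (cases "y = 0") (auto simp: powr_numeral)

lemma square_integrable: "integrable M (\<lambda>\<omega>. (Y \<omega>)\<^sup>2)"
  and variance_le: "expectation (\<lambda>\<omega>. (Y \<omega>)\<^sup>2) \<le> 1 + K"
  using lower_moment[of 2] \<delta>_pos unfolding square_eq_powr by auto

lemma prob_exceeds:
  assumes "0 < b"
  shows "emeasure M {\<omega>\<in>space M. b < \<bar>Y \<omega>\<bar>} \<le> ennreal (K * b powr (- (2 + \<delta>)))"
proof -
  have "prob {\<omega>\<in>space M. b < \<bar>Y \<omega>\<bar>} = expectation (indicator {\<omega>\<in>space M. b < \<bar>Y \<omega>\<bar>})"
    by simp
  also have "\<dots> \<le> expectation (\<lambda>\<omega>. \<bar>Y \<omega>\<bar> powr (2 + \<delta>) * b powr (- (2 + \<delta>)))"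
  proof (rule integral_mono)
    show "integrable M (indicator {\<omega>\<in>space M. b < \<bar>Y \<omega>\<bar>} :: 'w \<Rightarrow> real)"
      by (intro integrable_real_indicator) (auto simp: less_top[symmetric])
    show "integrable M (\<lambda>\<omega>. \<bar>Y \<omega>\<bar> powr (2 + \<delta>) * b powr (- (2 + \<delta>)))"
      using moment_integrable by simp
    fix \<omega>
    show "indicator {\<omega>\<in>space M. b < \<bar>Y \<omega>\<bar>} \<omega> \<le> \<bar>Y \<omega>\<bar> powr (2 + \<delta>) * b powr (- (2 + \<delta>))"
    proof (cases "b < \<bar>Y \<omega>\<bar>")
      case True
      have "1 = b powr (2 + \<delta>) * b powr (- (2 + \<delta>))" using assms by (simp add: powr_add[symmetric])
      also have "\<dots> \<le> \<bar>Y \<omega>\<bar> powr (2 + \<delta>) * b powr (- (2 + \<delta>))"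
        using True assms \<delta>_pos by (intro mult_right_mono powr_mono2) auto
      finally show ?thesis by (simp add: indicator_def)
    qed (simp add: indicator_def)
  qed
  also have "\<dots> \<le> K * b powr (- (2 + \<delta>))"
    using moment_le by (simp add: mult_right_mono)
  finally show ?thesis by (simp add: emeasure_eq_measure ennreal_leI)
qed

lemma trunc_integrable: "integrable M (\<lambda>\<omega>. trunc b (Y \<omega>))"
  by (rule Bochner_Integration.integrable_bound[OF Y_integrable]) (auto simp: trunc_def)

text \<open>As the mean is 0, the truncated mean is minus the mean of the part cut off, where
\<open>\<bar>Y\<bar> \<le> \<bar>Y\<bar> powr (2 + \<delta>) * b powr (- (1 + \<delta>))\<close>.\<close>

lemma truncation_bias:
  assumes "0 < b"
  shows "\<bar>expectation (\<lambda>\<omega>. trunc b (Y \<omega>))\<bar> \<le> K * b powr (- (1 + \<delta>))"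
proof -
  have "expectation (\<lambda>\<omega>. trunc b (Y \<omega>)) = expectation (\<lambda>\<omega>. trunc b (Y \<omega>) - Y \<omega>)"
    using trunc_integrable Y_integrable Y_centred by simp
  also have "\<bar>\<dots>\<bar> \<le> expectation (\<lambda>\<omega>. \<bar>trunc b (Y \<omega>) - Y \<omega>\<bar>)"
    by (rule integral_abs_bound)
  also have "\<dots> \<le> expectation (\<lambda>\<omega>. \<bar>Y \<omega>\<bar> powr (2 + \<delta>) * b powr (- (1 + \<delta>)))"
  proof (rule integral_mono)
    show "integrable M (\<lambda>\<omega>. \<bar>trunc b (Y \<omega>) - Y \<omega>\<bar>)"
      using trunc_integrable Y_integrable by auto
    show "integrable M (\<lambda>\<omega>. \<bar>Y \<omega>\<bar> powr (2 + \<delta>) * b powr (- (1 + \<delta>)))"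
      using moment_integrable by simp
    fix \<omega>
    show "\<bar>trunc b (Y \<omega>) - Y \<omega>\<bar> \<le> \<bar>Y \<omega>\<bar> powr (2 + \<delta>) * b powr (- (1 + \<delta>))"
    proof (cases "b < \<bar>Y \<omega>\<bar>")
      case True
      have "\<bar>Y \<omega>\<bar> = \<bar>Y \<omega>\<bar> * (b powr (1 + \<delta>) * b powr (- (1 + \<delta>)))"
        using assms by (simp add: powr_add[symmetric])
      also have "\<dots> \<le> \<bar>Y \<omega>\<bar> * (\<bar>Y \<omega>\<bar> powr (1 + \<delta>) * b powr (- (1 + \<delta>)))"
        using True assms \<delta>_pos by (intro mult_left_mono mult_right_mono powr_mono2) auto
      also have "\<dots> = \<bar>Y \<omega>\<bar> powr (2 + \<delta>) * b powr (- (1 + \<delta>))"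
      proof -
        have "2 + \<delta> = 1 + (1 + \<delta>)" by simp
        then show ?thesis using True assms by (simp only: powr_add[of _ 1 "1 + \<delta>"]) simp
      qed
      finally show ?thesis using True by (simp add: trunc_def)
    qed (simp add: trunc_def)
  qed
  also have "\<dots> \<le> K * b powr (- (1 + \<delta>))"
    using moment_le by (simp add: mult_right_mono)
  finally show ?thesis .
qed

text \<open>The recentred variable is bounded by \<open>2b\<close> and its variance does not exceed that of \<open>Y\<close>. When
\<open>2b\<bar>l\<bar> \<le> x\<close> the cubic remainder inflates the quadratic term by at most the factor \<open>1 + x\<close>.\<close>

lemma truncated_subgaussian:
  assumes "0 \<le> b" "2 * b * \<bar>l\<bar> \<le> x" "x \<le> 1"
  shows "(\<integral>\<^sup>+\<omega>. ennreal (exp (l * (trunc b (Y \<omega>) - expectation (\<lambda>\<omega>. trunc b (Y \<omega>))))) \<partial>M)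
    \<le> ennreal (exp (l\<^sup>2 * (expectation (\<lambda>\<omega>. (Y \<omega>)\<^sup>2) * (1 + x)) / 2))"
proof -
  define e where "e = expectation (\<lambda>\<omega>. trunc b (Y \<omega>))"
  define Z where "Z \<omega> = trunc b (Y \<omega>) - e" for \<omega>
  define v where "v = expectation (\<lambda>\<omega>. (Y \<omega>)\<^sup>2)"
  have x: "0 \<le> x" using assms by (meson abs_ge_zero mult_nonneg_nonneg order_trans zero_le_numeral)
  have [measurable]: "Z \<in> borel_measurable M" unfolding Z_def by measurable
  have tb: "\<bar>trunc b (Y \<omega>)\<bar> \<le> b" for \<omega> using assms by (simp add: trunc_def)
  have "\<bar>e\<bar> \<le> expectation (\<lambda>\<omega>. \<bar>trunc b (Y \<omega>)\<bar>)" unfolding e_def by (rule integral_abs_bound)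
  also have "\<dots> \<le> expectation (\<lambda>\<omega>. b)" using tb trunc_integrable by (intro integral_mono) auto
  finally have eb: "\<bar>e\<bar> \<le> b" by (simp add: prob_space)
  have Zb: "\<bar>Z \<omega>\<bar> \<le> 2 * b" for \<omega> using tb[of \<omega>] eb unfolding Z_def by linarith
  have Z_int: "integrable M Z" unfolding Z_def using trunc_integrable by simp
  have Z_mean: "expectation Z = 0" unfolding Z_def using trunc_integrable by (simp add: e_def prob_space)
  have T2: "integrable M (\<lambda>\<omega>. (trunc b (Y \<omega>))\<^sup>2)"
    by (rule Bochner_Integration.integrable_bound[OF square_integrable]) (auto simp: trunc_def)
  have Z2_eq: "(Z \<omega>)\<^sup>2 = (trunc b (Y \<omega>))\<^sup>2 - 2 * e * trunc b (Y \<omega>) + e\<^sup>2" for \<omega>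
    by (simp add: Z_def power2_eq_square algebra_simps)
  have Z2_int: "integrable M (\<lambda>\<omega>. (Z \<omega>)\<^sup>2)" unfolding Z2_eq using T2 trunc_integrable by simp
  have "expectation (\<lambda>\<omega>. (Z \<omega>)\<^sup>2) = expectation (\<lambda>\<omega>. (trunc b (Y \<omega>))\<^sup>2) - e\<^sup>2"
    unfolding Z2_eq using T2 trunc_integrable by (simp add: e_def[symmetric] prob_space power2_eq_square)
  also have "\<dots> \<le> expectation (\<lambda>\<omega>. (trunc b (Y \<omega>))\<^sup>2)" by simp
  also have "\<dots> \<le> v" unfolding v_def using T2 square_integrable
    by (intro integral_mono) (auto simp: trunc_def)
  finally have Z2_le: "expectation (\<lambda>\<omega>. (Z \<omega>)\<^sup>2) \<le> v" .
  have pointwise: "exp (l * Z \<omega>) \<le> 1 + l * Z \<omega> + (l\<^sup>2 * (1 + x) / 2) * (Z \<omega>)\<^sup>2" for \<omega>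
  proof -
    have "\<bar>l * Z \<omega>\<bar> \<le> \<bar>l\<bar> * (2 * b)" unfolding abs_mult by (intro mult_left_mono Zb) auto
    then have lx: "\<bar>l * Z \<omega>\<bar> \<le> x" using assms by (simp add: mult_ac)
    then have "exp (l * Z \<omega>) \<le> 1 + l * Z \<omega> + (l * Z \<omega>)\<^sup>2 / 2 * (1 + \<bar>l * Z \<omega>\<bar>)"
      using assms by (intro exp_le_quadratic_cubic) auto
    also have "\<dots> \<le> 1 + l * Z \<omega> + (l * Z \<omega>)\<^sup>2 / 2 * (1 + x)"
      using lx by (intro add_left_mono mult_left_mono) auto
    finally show ?thesis by (simp add: power_mult_distrib mult_ac)
  qed
  have int: "integrable M (\<lambda>\<omega>. 1 + l * Z \<omega> + (l\<^sup>2 * (1 + x) / 2) * (Z \<omega>)\<^sup>2)"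
    using Z_int Z2_int by simp
  have "(\<integral>\<^sup>+\<omega>. ennreal (exp (l * Z \<omega>)) \<partial>M) \<le> (\<integral>\<^sup>+\<omega>. ennreal (1 + l * Z \<omega> + (l\<^sup>2 * (1 + x) / 2) * (Z \<omega>)\<^sup>2) \<partial>M)"
    by (intro nn_integral_mono ennreal_leI pointwise)
  also have "\<dots> = ennreal (expectation (\<lambda>\<omega>. 1 + l * Z \<omega> + (l\<^sup>2 * (1 + x) / 2) * (Z \<omega>)\<^sup>2))"
    using pointwise order_trans[OF less_imp_le[OF exp_gt_zero]] by (intro nn_integral_eq_integral int AE_I2) blast
  also have "expectation (\<lambda>\<omega>. 1 + l * Z \<omega> + (l\<^sup>2 * (1 + x) / 2) * (Z \<omega>)\<^sup>2)
     = 1 + (l\<^sup>2 * (1 + x) / 2) * expectation (\<lambda>\<omega>. (Z \<omega>)\<^sup>2)"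
    using Z_int Z2_int Z_mean by (simp add: prob_space)
  also have "ennreal \<dots> \<le> ennreal (exp (l\<^sup>2 * (v * (1 + x)) / 2))"
  proof (rule ennreal_leI)
    have "1 + (l\<^sup>2 * (1 + x) / 2) * expectation (\<lambda>\<omega>. (Z \<omega>)\<^sup>2) \<le> 1 + (l\<^sup>2 * (1 + x) / 2) * v"
      using Z2_le x by (intro add_left_mono mult_left_mono) auto
    also have "\<dots> \<le> exp ((l\<^sup>2 * (1 + x) / 2) * v)" by (rule exp_ge_add_one_self)
    finally show "1 + (l\<^sup>2 * (1 + x) / 2) * expectation (\<lambda>\<omega>. (Z \<omega>)\<^sup>2) \<le> exp (l\<^sup>2 * (v * (1 + x)) / 2)"
      by (simp add: mult_ac)
  qed
  finally show ?thesis unfolding Z_def e_def v_def .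
qed

text \<open>As \<open>Y\<^sup>2\<close> is nonnegative, a moment of order \<open>2 + 2d\<close> of \<open>Y\<close> is enough to make the lower tail of sums of
squares light; the choice of \<open>\<theta>\<close> trades the error term against the linear one.\<close>

lemma exp_minus_square_le:
  assumes "0 \<le> \<theta>" "0 < d" "d \<le> 1" "2 * d \<le> \<delta>"
  shows "(\<integral>\<^sup>+\<omega>. ennreal (exp (- (\<theta> * (Y \<omega>)\<^sup>2))) \<partial>M)
    \<le> ennreal (exp (\<theta> powr (1 + d) * (1 + K) - \<theta> * expectation (\<lambda>\<omega>. (Y \<omega>)\<^sup>2)))"
proof -
  define v where "v = expectation (\<lambda>\<omega>. (Y \<omega>)\<^sup>2)"
  have p: "0 \<le> 2 + 2 * d" "2 + 2 * d \<le> 2 + \<delta>" using assms by auto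
  have pointwise: "exp (- (\<theta> * (Y \<omega>)\<^sup>2)) \<le> 1 - \<theta> * (Y \<omega>)\<^sup>2 + \<theta> powr (1 + d) * \<bar>Y \<omega>\<bar> powr (2 + 2 * d)" for \<omega>
  proof -
    have "(\<theta> * (Y \<omega>)\<^sup>2) powr (1 + d) = \<theta> powr (1 + d) * \<bar>Y \<omega>\<bar> powr (2 + 2 * d)"
    proof -
      have "(Y \<omega>)\<^sup>2 powr (1 + d) = \<bar>Y \<omega>\<bar> powr (2 + 2 * d)"
        unfolding square_eq_powr powr_powr by (simp only: distrib_left mult_1_right)
      then show ?thesis using assms by (simp add: powr_mult)
    qed
    then show ?thesis using exp_minus_le_powr[of "\<theta> * (Y \<omega>)\<^sup>2" d] assms by simp
  qed
  have int: "integrable M (\<lambda>\<omega>. 1 - \<theta> * (Y \<omega>)\<^sup>2 + \<theta> powr (1 + d) * \<bar>Y \<omega>\<bar> powr (2 + 2 * d))"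
    using square_integrable lower_moment(1)[OF p] by simp
  have "(\<integral>\<^sup>+\<omega>. ennreal (exp (- (\<theta> * (Y \<omega>)\<^sup>2))) \<partial>M)
    \<le> (\<integral>\<^sup>+\<omega>. ennreal (1 - \<theta> * (Y \<omega>)\<^sup>2 + \<theta> powr (1 + d) * \<bar>Y \<omega>\<bar> powr (2 + 2 * d)) \<partial>M)"
    by (intro nn_integral_mono ennreal_leI pointwise)
  also have "\<dots> = ennreal (expectation (\<lambda>\<omega>. 1 - \<theta> * (Y \<omega>)\<^sup>2 + \<theta> powr (1 + d) * \<bar>Y \<omega>\<bar> powr (2 + 2 * d)))"
    using pointwise order_trans[OF less_imp_le[OF exp_gt_zero]] by (intro nn_integral_eq_integral int AE_I2) blast
  also have "expectation (\<lambda>\<omega>. 1 - \<theta> * (Y \<omega>)\<^sup>2 + \<theta> powr (1 + d) * \<bar>Y \<omega>\<bar> powr (2 + 2 * d))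
     = 1 - \<theta> * v + \<theta> powr (1 + d) * expectation (\<lambda>\<omega>. \<bar>Y \<omega>\<bar> powr (2 + 2 * d))"
    using square_integrable lower_moment(1)[OF p] by (simp add: prob_space v_def)
  also have "ennreal \<dots> \<le> ennreal (exp (\<theta> powr (1 + d) * (1 + K) - \<theta> * v))"
  proof (rule ennreal_leI)
    have "\<theta> powr (1 + d) * expectation (\<lambda>\<omega>. \<bar>Y \<omega>\<bar> powr (2 + 2 * d)) \<le> \<theta> powr (1 + d) * (1 + K)"
      using lower_moment(2)[OF p] by (intro mult_left_mono) auto
    moreover have "1 + (\<theta> powr (1 + d) * (1 + K) - \<theta> * v) \<le> exp (\<theta> powr (1 + d) * (1 + K) - \<theta> * v)"
      by (rule exp_ge_add_one_self)
    ultimately show "1 - \<theta> * v + \<theta> powr (1 + d) * expectation (\<lambda>\<omega>. \<bar>Y \<omega>\<bar> powr (2 + 2 * d))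
        \<le> exp (\<theta> powr (1 + d) * (1 + K) - \<theta> * v)" by linarith
  qed
  finally show ?thesis unfolding v_def .
qed

end

locale moment_sequence = independent_sequence M X
  for M :: "'w measure" and X :: "nat \<Rightarrow> 'w \<Rightarrow> real" +
  fixes \<mu> \<delta> K v :: real
  assumes moment: "\<And>i. 1 \<le> i \<Longrightarrow> moment_variable M (\<lambda>\<omega>. X i \<omega> - \<mu>) \<delta> K"
    and variance: "\<And>i. 1 \<le> i \<Longrightarrow> expectation (\<lambda>\<omega>. (X i \<omega> - \<mu>)\<^sup>2) = v"
begin

text \<open>Chernoff's bound for the lower tail, with exponent \<open>-\<theta>\<close>.\<close>

lemma prob_small_sum_squares:
  assumes "0 \<le> \<theta>" "0 < d" "d \<le> 1" "2 * d \<le> \<delta>"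
  shows "emeasure M {\<omega>\<in>space M. (\<Sum>i=1..k. (X i \<omega> - \<mu>)\<^sup>2) \<le> real k * (v - \<epsilon>)}
    \<le> ennreal (exp (real k * (\<theta> powr (1 + d) * (1 + K) - \<theta> * \<epsilon>)))"
proof -
  let ?A = "{\<omega>\<in>space M. (\<Sum>i=1..k. (X i \<omega> - \<mu>)\<^sup>2) \<le> real k * (v - \<epsilon>)}"
  let ?Q = "exp (\<theta> powr (1 + d) * (1 + K) - \<theta> * v)"
  have [measurable]: "X i \<in> borel_measurable M" if "i \<in> {1..k}" for i
    using that X_measurable by auto
  have A[measurable]: "?A \<in> sets M" by measurable
  have "indep_vars (\<lambda>_. borel) X {1..k}" by (rule indep_vars_subset[OF indep]) auto
  then have ind: "indep_vars (\<lambda>_. borel) (\<lambda>i \<omega>. ennreal (exp (- (\<theta> * (X i \<omega> - \<mu>)\<^sup>2)))) {1..k}"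
    by (rule indep_vars_compose2) auto
  have "emeasure M ?A = (\<integral>\<^sup>+\<omega>. indicator ?A \<omega> \<partial>M)" by simp
  also have "\<dots> \<le> (\<integral>\<^sup>+\<omega>. ennreal (exp (\<theta> * (real k * (v - \<epsilon>)))) * ennreal (\<Prod>i=1..k. exp (- (\<theta> * (X i \<omega> - \<mu>)\<^sup>2))) \<partial>M)"
  proof (rule nn_integral_mono)
    fix \<omega>
    show "indicator ?A \<omega> \<le> ennreal (exp (\<theta> * (real k * (v - \<epsilon>)))) * ennreal (\<Prod>i=1..k. exp (- (\<theta> * (X i \<omega> - \<mu>)\<^sup>2)))"
    proof (cases "\<omega> \<in> ?A")
      case True
      have "exp (\<theta> * (real k * (v - \<epsilon>))) * (\<Prod>i=1..k. exp (- (\<theta> * (X i \<omega> - \<mu>)\<^sup>2)))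
        = exp (\<theta> * (real k * (v - \<epsilon>) - (\<Sum>i=1..k. (X i \<omega> - \<mu>)\<^sup>2)))"
        by (simp add: exp_sum[symmetric] exp_add[symmetric] sum_negf sum_distrib_left[symmetric] right_diff_distrib)
      moreover have "0 \<le> \<theta> * (real k * (v - \<epsilon>) - (\<Sum>i=1..k. (X i \<omega> - \<mu>)\<^sup>2))"
        using True assms by (intro mult_nonneg_nonneg) auto
      ultimately have "1 \<le> exp (\<theta> * (real k * (v - \<epsilon>))) * (\<Prod>i=1..k. exp (- (\<theta> * (X i \<omega> - \<mu>)\<^sup>2)))"
        by simp
      then have "ennreal 1 \<le> ennreal (exp (\<theta> * (real k * (v - \<epsilon>))) * (\<Prod>i=1..k. exp (- (\<theta> * (X i \<omega> - \<mu>)\<^sup>2))))"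
        by (rule ennreal_leI)
      then show ?thesis using True by (simp add: ennreal_mult prod_nonneg)
    qed simp
  qed
  also have "\<dots> = ennreal (exp (\<theta> * (real k * (v - \<epsilon>)))) * (\<integral>\<^sup>+\<omega>. ennreal (\<Prod>i=1..k. exp (- (\<theta> * (X i \<omega> - \<mu>)\<^sup>2))) \<partial>M)"
    by (intro nn_integral_cmult) measurable
  also have "(\<integral>\<^sup>+\<omega>. ennreal (\<Prod>i=1..k. exp (- (\<theta> * (X i \<omega> - \<mu>)\<^sup>2))) \<partial>M)
     = (\<Prod>i=1..k. \<integral>\<^sup>+\<omega>. ennreal (exp (- (\<theta> * (X i \<omega> - \<mu>)\<^sup>2))) \<partial>M)"
    using indep_vars_nn_integral[OF _ ind] by (simp add: prod_ennreal)
  also have "\<dots> \<le> (\<Prod>i=1..k. ennreal ?Q)"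
  proof (rule prod_mono_ennreal)
    fix i assume "i \<in> {1..k}"
    then have i: "1 \<le> i" by simp
    interpret Y: moment_variable M "\<lambda>\<omega>. X i \<omega> - \<mu>" \<delta> K by (rule moment[OF i])
    show "(\<integral>\<^sup>+\<omega>. ennreal (exp (- (\<theta> * (X i \<omega> - \<mu>)\<^sup>2))) \<partial>M) \<le> ennreal ?Q"
      using Y.exp_minus_square_le[OF assms] variance[OF i] by simp
  qed
  also have "\<dots> = ennreal (?Q ^ k)" by (simp add: ennreal_power)
  also have "ennreal (exp (\<theta> * (real k * (v - \<epsilon>)))) * ennreal (?Q ^ k) =
     ennreal (exp (real k * (\<theta> powr (1 + d) * (1 + K) - \<theta> * \<epsilon>)))"
    unfolding exp_of_nat_mult[symmetric] ennreal_mult[symmetric, OF exp_ge_zero exp_ge_zero] exp_add[symmetric]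
    by (simp add: algebra_simps)
  finally show ?thesis by (simp add: mult_left_mono)
qed

end

section \<open>Choice of exponents and the truncated walk\<close>

text \<open>The unit in which the exponents are measured. Truncating at \<open>i powr (1/2 - 4 \<eta>)\<close> costs a probability
\<open>i powr (- (1/2 - 4 \<eta>) (2 + \<delta>)) = i powr (- (1 + 3\<delta>/10))\<close>, which is summable with room to spare over
\<open>0.24 \<delta>\<close>, while the level stays well below the scale \<open>i powr (1/2)\<close> of the walk.\<close>

definition eta :: "real \<Rightarrow> real" where
  "eta \<delta> = \<delta> / (20 * (2 + \<delta>))"

lemma eta_bounds:
  assumes "0 < \<delta>"
  shows "0 < eta \<delta>" "eta \<delta> < 1 / 20" "eta \<delta> * (2 + \<delta>) = \<delta> / 20"
  using assms by (auto simp: eta_def field_simps)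

text \<open>How large \<open>m\<close> has to be; the requirements involve the law only through \<open>K\<close>. Each says that a
power of \<open>m\<close> dominates the logarithm by which the slack of the variance estimate is reduced. The
quantity \<open>min (\<delta>/2) 1\<close> is the order \<open>d\<close> used for the lower tail of the sum of squares, and the last
line makes stretched exponential tails summable at the rate needed.\<close>

definition large_index :: "real \<Rightarrow> real \<Rightarrow> nat \<Rightarrow> bool" where
  "large_index \<delta> K m \<longleftrightarrow> 3 \<le> m \<and>
     4 * (1 + K) * ln (real m) \<le> real m powr (2 * eta \<delta>) \<and>
     8 * ln (real m) \<le> real m powr (eta \<delta>) \<and>
     8 * ln (real m) \<le> real m powr (1/4) \<and>
     8 * (1 + K) * ln (real m) \<le> real m powr (min (\<delta> / 2) 1 / 4) \<and>
     (\<forall>k\<ge>m. exp (- (real k powr (eta \<delta>))) \<le> real k powr (- (2 + \<delta>)))"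

lemma eventually_ln_le_powr:
  assumes "0 < p"
  shows "eventually (\<lambda>m. a * ln (real m) \<le> real m powr p) sequentially"
proof -
  have "((\<lambda>m. a * ln (real m) / real m powr p) \<longlongrightarrow> 0) sequentially"
    using assms by real_asymp
  then have "eventually (\<lambda>m. a * ln (real m) / real m powr p < 1) sequentially"
    by (rule order_tendstoD) simp
  then show ?thesis using eventually_gt_at_top[of 0]
    by eventually_elim (simp add: field_simps)
qed

lemma eventually_large_index:
  assumes "0 < \<delta>"
  shows "eventually (large_index \<delta> K) sequentially"
proof -
  note eta = eta_bounds[OF assms]
  have "((\<lambda>k. exp (- (real k powr (eta \<delta>))) * real k powr (2 + \<delta>)) \<longlongrightarrow> 0) sequentially"
    using eta(1) by real_asymp
  then have "eventually (\<lambda>k. exp (- (real k powr (eta \<delta>))) * real k powr (2 + \<delta>) < 1) sequentially"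
    by (rule order_tendstoD) simp
  then have "eventually (\<lambda>k. exp (- (real k powr (eta \<delta>))) \<le> real k powr (- (2 + \<delta>))) sequentially"
    using eventually_gt_at_top[of 0] by eventually_elim (subst powr_minus, simp add: field_simps)
  then have "eventually (\<lambda>m. \<forall>k\<ge>m. exp (- (real k powr (eta \<delta>))) \<le> real k powr (- (2 + \<delta>))) sequentially"
    by (rule eventually_all_ge_at_top)
  moreover have "0 < min (\<delta> / 2) 1 / 4" using assms by simp
  ultimately show ?thesis unfolding large_index_def
    using eta by (intro eventually_conj eventually_ge_at_top eventually_ln_le_powr) auto
qed

text \<open>One law of the class and one sufficiently large \<open>m\<close>, both fixed.\<close>

locale large_index_sample = moment_sequence M X \<mu> \<delta> K v
  for M :: "'w measure" and X :: "nat \<Rightarrow> 'w \<Rightarrow> real" and \<mu> \<delta> K v :: real +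
  fixes m :: nat
  assumes large: "large_index \<delta> K m"
begin

abbreviation \<eta> :: real where "\<eta> \<equiv> eta \<delta>"
abbreviation \<Lambda> :: real where "\<Lambda> \<equiv> ln (real m)"

lemma \<delta>_pos: "0 < \<delta>" and K_nonneg: "0 \<le> K" and v_le: "v \<le> 1 + K" and v_nonneg: "0 \<le> v"
proof -
  interpret Y: moment_variable M "\<lambda>\<omega>. X 1 \<omega> - \<mu>" \<delta> K by (rule moment) simp
  show "0 < \<delta>" "0 \<le> K" "v \<le> 1 + K" using Y.\<delta>_pos Y.K_nonneg Y.variance_le variance[of 1] by auto
  have "0 \<le> expectation (\<lambda>\<omega>. (X 1 \<omega> - \<mu>)\<^sup>2)" by simp
  then show "0 \<le> v" using variance[OF order_refl] by metis
qed

lemmas \<eta>_bounds = eta_bounds[OF \<delta>_pos]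

lemma m_ge: "3 \<le> m" and \<Lambda>_le_K: "4 * (1 + K) * \<Lambda> \<le> real m powr (2 * \<eta>)"
  and \<Lambda>_le_\<eta>: "8 * \<Lambda> \<le> real m powr \<eta>" and \<Lambda>_le_quarter: "8 * \<Lambda> \<le> real m powr (1/4)"
  and \<Lambda>_le_d: "8 * (1 + K) * \<Lambda> \<le> real m powr (min (\<delta> / 2) 1 / 4)"
  and exp_powr_le: "m \<le> k \<Longrightarrow> exp (- (real k powr \<eta>)) \<le> real k powr (- (2 + \<delta>))"
  using large unfolding large_index_def by blast+

lemma \<Lambda>_ge_1: "1 \<le> \<Lambda>"
proof -
  have "exp 1 \<le> real m" using exp_le m_ge by linarith
  then show ?thesis using m_ge by (subst ln_ge_iff) auto
qed

text \<open>Up to time \<open>m\<close> the levels stay constant: coverage is only claimed from \<open>m\<close> on, and constant levels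
make the early truncation probabilities small as well. The increments are recentred, because a bias
of any sign would destroy the supermartingale property for \<open>l\<close> close to 0.\<close>

definition b :: "nat \<Rightarrow> real" where "b i = real (max i m) powr (1/2 - 4 * \<eta>)"
definition c :: "nat \<Rightarrow> real" where "c i = real (max i m) powr (2 * \<eta> - 1/2)"
definition s :: real where "s = v + 1 / (2 * \<Lambda>)"
definition g :: "nat \<Rightarrow> real \<Rightarrow> real" where
  "g i x = trunc (b i) (x - \<mu>) - expectation (\<lambda>\<omega>. trunc (b i) (X i \<omega> - \<mu>))"

lemma b_pos: "0 < b i" using m_ge by (simp add: b_def max_def)
lemma c_pos: "0 < c i" using m_ge by (simp add: c_def max_def)

lemma quarter_powr_le: "real m powr (- (1/4)) \<le> 1 / (8 * \<Lambda>)"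
  using le_imp_inverse_le[OF \<Lambda>_le_quarter] \<Lambda>_ge_1 by (simp add: powr_minus inverse_eq_divide)

text \<open>The factor \<open>1 + x\<close> from truncation, with \<open>x = 2 m powr (-2\<eta>)\<close>, is absorbed by the summand
\<open>1/(2\<Lambda>)\<close> of \<open>s\<close>, since the variance is at most \<open>1 + K\<close>.\<close>

lemma slack: "2 * real m powr (- 2 * \<eta>) * (1 + K) \<le> 1 / (2 * \<Lambda>)"
  using \<Lambda>_le_K \<Lambda>_ge_1 m_ge by (simp add: powr_minus field_simps)

lemma b_times_c: "2 * b i * c i \<le> 2 * real m powr (- 2 * \<eta>)"
proof -
  have "b i * c i = real (max i m) powr (- 2 * \<eta>)"
    unfolding b_def c_def powr_add[symmetric] by simp
  also have "\<dots> \<le> real m powr (- 2 * \<eta>)"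
    using m_ge \<eta>_bounds by (intro powr_mono2') auto
  finally show ?thesis by simp
qed

end

sublocale large_index_sample \<subseteq> subgaussian_steps M X g s c
proof
  show "g i \<in> borel_measurable borel" for i unfolding g_def by measurable
  show "antimono c"
    unfolding c_def using m_ge \<eta>_bounds by (intro antimonoI powr_mono2') auto
  fix i l assume i: "1 \<le> i" and l: "\<bar>l\<bar> \<le> c i"
  interpret Y: moment_variable M "\<lambda>\<omega>. X i \<omega> - \<mu>" \<delta> K by (rule moment[OF i])
  define x where "x = 2 * real m powr (- 2 * \<eta>)"
  have x0: "0 \<le> x" by (simp add: x_def)
  have "2 * b i * \<bar>l\<bar> \<le> 2 * b i * c i" using l b_pos[of i] by (intro mult_left_mono) auto
  then have lx: "2 * b i * \<bar>l\<bar> \<le> x" using b_times_c[of i] by (simp add: x_def)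
  have xK: "x * (1 + K) \<le> 1 / (2 * \<Lambda>)" using slack by (simp add: x_def)
  have "x \<le> x * (1 + K)" using x0 K_nonneg by (simp add: algebra_simps)
  also have "\<dots> \<le> 1 / (2 * \<Lambda>)" by (rule xK)
  also have "\<dots> \<le> 1" using \<Lambda>_ge_1 by simp
  finally have x1: "x \<le> 1" .
  have "v * x \<le> (1 + K) * x" using v_le x0 by (rule mult_right_mono)
  then have "v * (1 + x) \<le> s" using xK by (simp add: s_def algebra_simps)
  then have "l\<^sup>2 * (v * (1 + x)) / 2 \<le> l\<^sup>2 * s / 2" by (intro divide_right_mono mult_left_mono) auto
  then have "ennreal (exp (l\<^sup>2 * (v * (1 + x)) / 2)) \<le> ennreal (exp (l\<^sup>2 * s / 2))" by (intro ennreal_leI) simp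
  then show "(\<integral>\<^sup>+\<omega>. ennreal (exp (l * g i (X i \<omega>))) \<partial>M) \<le> ennreal (exp (l\<^sup>2 * s / 2))"
    using Y.truncated_subgaussian[OF less_imp_le[OF b_pos] lx x1]
    unfolding variance[OF i] g_def by (rule order_trans[rotated])
qed

section \<open>Probability of the exceptional event\<close>

context large_index_sample
begin

text \<open>The conditions on the walk and on the squares are imposed from time \<open>m\<close> on only, since at
a fixed early time they may fail with a probability that does not tend to 0 as \<open>m\<close> grows.\<close>

definition exceptional_at :: "nat \<Rightarrow> 'w set" where
  "exceptional_at i = {\<omega>\<in>space M. b i < \<bar>X i \<omega> - \<mu>\<bar>} \<union>
     (if m \<le> i then {\<omega>\<in>space M. real i powr (1/2 + \<eta>) \<le> \<bar>W i \<omega>\<bar>} \<union>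
        {\<omega>\<in>space M. (\<Sum>j=1..i. (X j \<omega> - \<mu>)\<^sup>2) \<le> real i * (v - 1 / (4 * \<Lambda>))} else {})"

definition exceptional :: "'w set" where "exceptional = (\<Union>i. exceptional_at (Suc i))"

lemma exceptional_at_measurable: "1 \<le> i \<Longrightarrow> exceptional_at i \<in> sets M"
proof -
  assume "1 \<le> i"
  then have [measurable]: "X i \<in> borel_measurable M" by (rule X_measurable)
  have [measurable]: "X j \<in> borel_measurable M" if "j \<in> {1..i}" for j
    using that by (intro X_measurable) auto
  show ?thesis
    by (cases "m \<le> i") (simp_all add: exceptional_at_def)
qed

lemma exceptional_measurable [measurable]: "exceptional \<in> sets M"
  unfolding exceptional_def by (intro sets.countable_UN) (auto intro: exceptional_at_measurable)

text \<open>Part of the decay is spent on the factor \<open>m powr (-\<delta>/4)\<close>; the rest keeps the sum over \<open>i\<close>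
finite, as \<open>\<delta>/4 + 1 + \<delta>/20 = 1 + 3\<delta>/10\<close>.\<close>

lemma index_powr_le:
  assumes "1 \<le> i" "1 + 3/10 * \<delta> \<le> p"
  shows "real (max i m) powr (- p) \<le> real m powr (- (\<delta> / 4)) * real i powr (- (1 + \<delta> / 20))"
proof -
  have "real (max i m) powr (- p) \<le> real (max i m) powr (- (\<delta> / 4) + - (1 + \<delta> / 20))"
    using assms \<delta>_pos by (intro powr_mono) auto
  also have "\<dots> = real (max i m) powr (- (\<delta> / 4)) * real (max i m) powr (- (1 + \<delta> / 20))"
    by (rule powr_add)
  also have "\<dots> \<le> real m powr (- (\<delta> / 4)) * real i powr (- (1 + \<delta> / 20))"
    using assms \<delta>_pos m_ge by (intro mult_mono powr_mono2') auto
  finally show ?thesis .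
qed

lemma prob_truncated:
  assumes "1 \<le> i"
  shows "emeasure M {\<omega>\<in>space M. b i < \<bar>X i \<omega> - \<mu>\<bar>} \<le>
    ennreal (K * (real m powr (- (\<delta> / 4)) * real i powr (- (1 + \<delta> / 20))))"
proof -
  interpret Y: moment_variable M "\<lambda>\<omega>. X i \<omega> - \<mu>" \<delta> K by (rule moment[OF assms])
  have "(1/2 - 4 * \<eta>) * (2 + \<delta>) = 1 + 3/10 * \<delta>"
    using \<eta>_bounds(3) by (simp add: algebra_simps)
  then have "b i powr (- (2 + \<delta>)) = real (max i m) powr (- (1 + 3/10 * \<delta>))"
    unfolding b_def powr_powr by (metis mult_minus_right)
  also have "\<dots> \<le> real m powr (- (\<delta> / 4)) * real i powr (- (1 + \<delta> / 20))"
    using assms by (intro index_powr_le) auto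
  finally have "K * b i powr (- (2 + \<delta>)) \<le> K * (real m powr (- (\<delta> / 4)) * real i powr (- (1 + \<delta> / 20)))"
    using K_nonneg by (rule mult_left_mono)
  then show ?thesis using Y.prob_exceeds[OF b_pos[of i]] by (meson ennreal_leI order_trans)
qed

lemma exp_powr_index_le:
  assumes "m \<le> k"
  shows "exp (- (real k powr \<eta>)) \<le> real m powr (- (\<delta> / 4)) * real k powr (- (1 + \<delta> / 20))"
  using exp_powr_le[OF assms] index_powr_le[of k "2 + \<delta>"] assms m_ge \<delta>_pos by (simp add: max_absorb1)

lemma s_le: "s \<le> 2 + K"
proof -
  have "1 / (2 * \<Lambda>) \<le> 1" using \<Lambda>_ge_1 by simp
  then show ?thesis using v_le by (simp add: s_def)
qed

text \<open>Chernoff's exponent \<open>r = k powr (-1/2)\<close> is admissible because \<open>r \<le> c k\<close>; it keeps the variance term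
bounded and leaves \<open>exp (- (k powr \<eta>))\<close>.\<close>

lemma prob_walk_large:
  assumes "m \<le> k"
  shows "emeasure M {\<omega>\<in>space M. real k powr (1/2 + \<eta>) \<le> \<bar>W k \<omega>\<bar>} \<le>
    ennreal (2 * exp (1 + K / 2) * (real m powr (- (\<delta> / 4)) * real k powr (- (1 + \<delta> / 20))))"
proof -
  have k: "1 \<le> real k" using assms m_ge by simp
  define r where "r = real k powr (- 1/2)"
  have "r \<le> c k" unfolding r_def c_def using assms k \<eta>_bounds by (simp add: max_absorb1 powr_mono)
  then have "emeasure M {\<omega>\<in>space M. real k powr (1/2 + \<eta>) \<le> \<bar>W k \<omega>\<bar>} \<le>
    ennreal (2 * exp (r\<^sup>2 * (real k * s) / 2 - r * real k powr (1/2 + \<eta>)))"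
    using k by (intro prob_W_deviation) (auto simp: r_def)
  also have "r\<^sup>2 = real k powr (- 1)"
    unfolding r_def power2_eq_square powr_add[symmetric] by simp
  then have "r\<^sup>2 * real k = 1" using k by (simp add: powr_minus)
  then have "r\<^sup>2 * (real k * s) / 2 - r * real k powr (1/2 + \<eta>) = s / 2 - real k powr \<eta>"
    by (simp add: r_def powr_add[symmetric] mult.assoc[symmetric])
  also have "2 * exp (s / 2 - real k powr \<eta>) \<le>
      2 * exp (1 + K / 2) * (real m powr (- (\<delta> / 4)) * real k powr (- (1 + \<delta> / 20)))"
  proof -
    have "exp (s / 2 - real k powr \<eta>) \<le> exp (1 + K / 2) * exp (- (real k powr \<eta>))"
      using s_le unfolding exp_add[symmetric] by simp
    also have "\<dots> \<le> exp (1 + K / 2) * (real m powr (- (\<delta> / 4)) * real k powr (- (1 + \<delta> / 20)))"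
      by (intro mult_left_mono exp_powr_index_le[OF assms]) auto
    finally show ?thesis by simp
  qed
  finally show ?thesis by (simp add: ennreal_leI)
qed

text \<open>With \<open>\<theta> = m powr (-1/4)\<close> the Chernoff exponent is at most \<open>- k \<theta> / (8\<Lambda>)\<close>, hence at most
\<open>- k m powr (-1/2) \<le> - k powr (1/2)\<close>.\<close>

lemma prob_squares_small:
  assumes "m \<le> k"
  shows "emeasure M {\<omega>\<in>space M. (\<Sum>j=1..k. (X j \<omega> - \<mu>)\<^sup>2) \<le> real k * (v - 1 / (4 * \<Lambda>))} \<le>
    ennreal (real m powr (- (\<delta> / 4)) * real k powr (- (1 + \<delta> / 20)))"
proof -
  have k: "1 \<le> real k" using assms m_ge by simp
  have m: "1 \<le> real m" using m_ge by simp
  define d where "d = min (\<delta> / 2) 1"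
  define \<theta> where "\<theta> = real m powr (- (1/4))"
  have d: "0 < d" "d \<le> 1" "2 * d \<le> \<delta>" using \<delta>_pos by (auto simp: d_def)
  have \<theta>: "0 \<le> \<theta>" by (simp add: \<theta>_def)
  have "\<theta> powr d = inverse (real m powr (d / 4))"
    unfolding \<theta>_def powr_powr powr_minus[symmetric] by simp
  then have "\<theta> powr d * (1 + K) = (1 + K) / real m powr (d / 4)"
    by (simp only: divide_inverse mult.commute)
  also have "\<dots> \<le> 1 / (8 * \<Lambda>)"
  proof -
    have "a / y \<le> 1 / (8 * \<Lambda>)" if "8 * a * \<Lambda> \<le> y" "0 < y" for a y
      using that \<Lambda>_ge_1 by (simp add: field_simps)
    then show ?thesis using \<Lambda>_le_d m unfolding d_def[symmetric] by simp
  qed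
  finally have "\<theta> powr d * (1 + K) \<le> 1 / (8 * \<Lambda>)" .
  then have "\<theta> * (\<theta> powr d * (1 + K)) \<le> \<theta> * (1 / (8 * \<Lambda>))" using \<theta> by (rule mult_left_mono)
  then have "\<theta> powr (1 + d) * (1 + K) - \<theta> * (1 / (4 * \<Lambda>)) \<le> - (\<theta> * (1 / (8 * \<Lambda>)))"
    using \<theta> m by (simp add: powr_add \<theta>_def field_simps)
  moreover have "real m powr (- (1/2)) \<le> \<theta> * (1 / (8 * \<Lambda>))"
  proof -
    have "real m powr (- (1/2)) = \<theta> * real m powr (- (1/4))"
      by (simp add: \<theta>_def powr_add[symmetric])
    also have "\<dots> \<le> \<theta> * (1 / (8 * \<Lambda>))"
      by (intro mult_left_mono quarter_powr_le \<theta>)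
    finally show ?thesis .
  qed
  moreover have "real k powr (- (1/2)) \<le> real m powr (- (1/2))"
    using assms m by (intro powr_mono2') auto
  ultimately have "\<theta> powr (1 + d) * (1 + K) - \<theta> * (1 / (4 * \<Lambda>)) \<le> - (real k powr (- (1/2)))" by linarith
  then have "real k * (\<theta> powr (1 + d) * (1 + K) - \<theta> * (1 / (4 * \<Lambda>))) \<le> real k * - (real k powr (- (1/2)))"
    using k by (intro mult_left_mono) auto
  also have "real k * - (real k powr (- (1/2))) = - (real k powr (1/2))"
  proof -
    have "real k * real k powr (- (1/2)) = real k powr 1 * real k powr (- (1/2))" using k by simp
    also have "\<dots> = real k powr (1/2)" unfolding powr_add[symmetric] by simp
    finally show ?thesis by simp
  qed
  also have "\<dots> \<le> - (real k powr \<eta>)" using k \<eta>_bounds by (simp add: powr_mono)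
  finally have "exp (real k * (\<theta> powr (1 + d) * (1 + K) - \<theta> * (1 / (4 * \<Lambda>)))) \<le> exp (- (real k powr \<eta>))"
    by simp
  also note exp_powr_index_le[OF assms]
  finally show ?thesis
    using prob_small_sum_squares[OF \<theta> d, of k "1 / (4 * \<Lambda>)"] by (meson ennreal_leI order_trans)
qed

definition exceptional_const :: real where
  "exceptional_const = (K + 2 * exp (1 + K / 2) + 1) * (\<Sum>i. real (Suc i) powr (- (1 + \<delta> / 20)))"

lemma prob_exceptional_at:
  assumes "1 \<le> i"
  shows "emeasure M (exceptional_at i) \<le>
    ennreal ((K + 2 * exp (1 + K / 2) + 1) * (real m powr (- (\<delta> / 4)) * real i powr (- (1 + \<delta> / 20))))"
proof -
  define q where "q = real m powr (- (\<delta> / 4)) * real i powr (- (1 + \<delta> / 20))"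
  have q: "0 \<le> q" by (simp add: q_def)
  have [measurable]: "X i \<in> borel_measurable M" by (rule X_measurable[OF assms])
  have [measurable]: "X j \<in> borel_measurable M" if "j \<in> {1..i}" for j
    using that by (intro X_measurable) auto
  let ?A = "{\<omega>\<in>space M. b i < \<bar>X i \<omega> - \<mu>\<bar>}"
  let ?B = "{\<omega>\<in>space M. real i powr (1/2 + \<eta>) \<le> \<bar>W i \<omega>\<bar>}"
  let ?C = "{\<omega>\<in>space M. (\<Sum>j=1..i. (X j \<omega> - \<mu>)\<^sup>2) \<le> real i * (v - 1 / (4 * \<Lambda>))}"
  have A: "emeasure M ?A \<le> ennreal (K * q)" using prob_truncated[OF assms] by (simp add: q_def)
  show ?thesis
  proof (cases "m \<le> i")
    case False
    then have "emeasure M (exceptional_at i) \<le> ennreal (K * q)" using A by (simp add: exceptional_at_def)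
    also have "\<dots> \<le> ennreal ((K + 2 * exp (1 + K / 2) + 1) * q)"
      using q by (intro ennreal_leI mult_right_mono) (auto simp: add_nonneg_nonneg)
    finally show ?thesis by (simp add: q_def)
  next
    case True
    then have "emeasure M (exceptional_at i) = emeasure M (?A \<union> (?B \<union> ?C))" by (simp add: exceptional_at_def)
    also have "\<dots> \<le> emeasure M ?A + emeasure M (?B \<union> ?C)"
      by (intro emeasure_subadditive) measurable
    also have "emeasure M (?B \<union> ?C) \<le> emeasure M ?B + emeasure M ?C"
      by (intro emeasure_subadditive) measurable
    also have "emeasure M ?A + (emeasure M ?B + emeasure M ?C)
        \<le> ennreal (K * q) + (ennreal (2 * exp (1 + K / 2) * q) + ennreal q)"
      using A prob_walk_large[OF True] prob_squares_small[OF True] by (intro add_mono) (simp_all add: q_def)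
    also have "\<dots> = ennreal ((K + 2 * exp (1 + K / 2) + 1) * q)"
      using K_nonneg q by (simp add: ennreal_plus[symmetric] algebra_simps del: ennreal_plus)
    finally show ?thesis by (simp add: q_def add_left_mono)
  qed
qed

lemma summable_weights: "summable (\<lambda>i. real (Suc i) powr (- (1 + \<delta> / 20)))"
proof -
  have "summable (\<lambda>i. real i powr (- (1 + \<delta> / 20)))"
    using \<delta>_pos by (subst summable_real_powr_iff) auto
  then show ?thesis by (subst summable_Suc_iff)
qed

lemma exceptional_const_nonneg: "0 \<le> exceptional_const"
proof -
  have "0 \<le> (\<Sum>i. real (Suc i) powr (- (1 + \<delta> / 20)))"
    by (rule suminf_nonneg[OF summable_weights]) (rule powr_ge_zero)
  moreover have "0 \<le> K + 2 * exp (1 + K / 2) + 1" using K_nonneg by (simp add: add_nonneg_nonneg)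
  ultimately show ?thesis unfolding exceptional_const_def by (intro mult_nonneg_nonneg)
qed

lemma prob_exceptional: "emeasure M exceptional \<le> ennreal (exceptional_const * real m powr (- (\<delta> / 4)))"
proof -
  define A where "A = (K + 2 * exp (1 + K / 2) + 1) * real m powr (- (\<delta> / 4))"
  have A: "0 \<le> A" using K_nonneg by (simp add: A_def)
  note sm = summable_weights
  have "emeasure M exceptional \<le> (\<Sum>i. emeasure M (exceptional_at (Suc i)))"
    unfolding exceptional_def by (intro emeasure_subadditive_countably) (auto intro: exceptional_at_measurable)
  also have "\<dots> \<le> (\<Sum>i. ennreal (A * real (Suc i) powr (- (1 + \<delta> / 20))))"
  proof (rule suminf_le)
    show "emeasure M (exceptional_at (Suc i)) \<le> ennreal (A * real (Suc i) powr (- (1 + \<delta> / 20)))" for i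
      using prob_exceptional_at[of "Suc i"] unfolding A_def mult.assoc by (simp only: le_add1 One_nat_def Suc_le_mono)
  qed auto
  also have "\<dots> = ennreal (\<Sum>i. A * real (Suc i) powr (- (1 + \<delta> / 20)))"
    using A sm by (intro suminf_ennreal2 summable_mult) auto
  also have "(\<Sum>i. A * real (Suc i) powr (- (1 + \<delta> / 20))) = A * (\<Sum>i. real (Suc i) powr (- (1 + \<delta> / 20)))"
    using sm by (rule suminf_mult)
  also have "\<dots> = exceptional_const * real m powr (- (\<delta> / 4))"
    by (simp add: A_def exceptional_const_def mult_ac)
  finally show ?thesis .
qed

section \<open>Comparison outside the exceptional event\<close>

text \<open>Off the exceptional event no truncation takes effect, so the difference is the deterministic sum of
the truncated means. Their decay is faster than \<open>i powr (-1/2)\<close> because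
\<open>(1/2 - 4\<eta>) (1 + \<delta>) \<ge> 1/2 + 4\<eta>\<close>.\<close>

lemma bias_small:
  assumes "m \<le> k" "\<omega> \<in> space M - exceptional"
  shows "\<bar>centred_sum X \<mu> k \<omega> - W k \<omega>\<bar> \<le> real k powr (1/2 - 2 * \<eta>)"
proof -
  have k: "1 \<le> real k" using assms m_ge by simp
  let ?e = "\<lambda>i. expectation (\<lambda>\<omega>. trunc (b i) (X i \<omega> - \<mu>))"
  have in_range: "\<bar>X i \<omega> - \<mu>\<bar> \<le> b i" if "1 \<le> i" for i
  proof -
    have "\<omega> \<notin> exceptional_at (Suc (i - 1))" using assms by (auto simp: exceptional_def)
    then show ?thesis using that assms by (auto simp: exceptional_at_def)
  qed
  have "centred_sum X \<mu> k \<omega> - W k \<omega> = (\<Sum>i=1..k. ?e i)"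
    unfolding centred_sum_def W_def sum_subtractf[symmetric]
    using in_range by (intro sum.cong) (auto simp: g_def trunc_def)
  also have "\<bar>\<dots>\<bar> \<le> (\<Sum>i=1..k. \<bar>?e i\<bar>)" by (rule sum_abs)
  also have "\<dots> \<le> (\<Sum>i=1..k. K * real i powr (1/2 - 4 * \<eta> - 1))"
  proof (rule sum_mono)
    fix i assume "i \<in> {1..k}"
    then have i: "1 \<le> i" by simp
    interpret Y: moment_variable M "\<lambda>\<omega>. X i \<omega> - \<mu>" \<delta> K by (rule moment[OF i])
    have "(1/2 - 4 * \<eta>) * - (1 + \<delta>) = 1/2 - 4 * \<eta> - 1 - \<delta> / 2 + 4 * (\<eta> * (2 + \<delta>))"
      by (simp add: field_simps)
    then have "(1/2 - 4 * \<eta>) * - (1 + \<delta>) \<le> 1/2 - 4 * \<eta> - 1"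
      using \<delta>_pos unfolding \<eta>_bounds(3) by linarith
    then have "b i powr (- (1 + \<delta>)) \<le> real (max i m) powr (1/2 - 4 * \<eta> - 1)"
      unfolding b_def powr_powr using i by (intro powr_mono) auto
    also have "\<dots> \<le> real i powr (1/2 - 4 * \<eta> - 1)" using i \<eta>_bounds by (intro powr_mono2') auto
    finally have "K * b i powr (- (1 + \<delta>)) \<le> K * real i powr (1/2 - 4 * \<eta> - 1)"
      using K_nonneg by (rule mult_left_mono)
    then show "\<bar>?e i\<bar> \<le> K * real i powr (1/2 - 4 * \<eta> - 1)"
      using Y.truncation_bias[OF b_pos[of i]] by linarith
  qed
  also have "\<dots> = K * (\<Sum>i=1..k. real i powr (1/2 - 4 * \<eta> - 1))" by (rule sum_distrib_left[symmetric])
  also have "\<dots> \<le> K * (real k powr (1/2 - 4 * \<eta>) / (1/2 - 4 * \<eta>))"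
    using \<eta>_bounds K_nonneg by (intro mult_left_mono sum_powr_le) auto
  also have "\<dots> \<le> K * (real k powr (1/2 - 4 * \<eta>) * 4)"
  proof -
    have "1 \<le> 4 * (1/2 - 4 * \<eta>)" using \<eta>_bounds by simp
    from mult_left_mono[OF this, of "real k powr (1/2 - 4 * \<eta>)"]
    have "real k powr (1/2 - 4 * \<eta>) / (1/2 - 4 * \<eta>) \<le> real k powr (1/2 - 4 * \<eta>) * 4"
      using \<eta>_bounds by (simp add: pos_divide_le_eq mult.assoc)
    then show ?thesis using K_nonneg by (rule mult_left_mono)
  qed
  also have "\<dots> = (4 * K) * real k powr (1/2 - 4 * \<eta>)" by simp
  also have "\<dots> \<le> real k powr (2 * \<eta>) * real k powr (1/2 - 4 * \<eta>)"
  proof (rule mult_right_mono)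
    \<comment> \<open>The constant is absorbed by a small power of \<open>k \<ge> m\<close>.\<close>
    have "4 * K \<le> 4 * (1 + K) * 1" by simp
    also have "\<dots> \<le> 4 * (1 + K) * \<Lambda>" using \<Lambda>_ge_1 K_nonneg by (intro mult_left_mono) auto
    also note \<Lambda>_le_K
    also have "real m powr (2 * \<eta>) \<le> real k powr (2 * \<eta>)" using assms \<eta>_bounds by (intro powr_mono2) auto
    finally show "4 * K \<le> real k powr (2 * \<eta>)" .
  qed simp
  also have "\<dots> = real k powr (1/2 - 2 * \<eta>)" unfolding powr_add[symmetric] by simp
  finally show ?thesis .
qed

lemma u_hat_nonneg: "0 \<le> u_hat X m k \<omega>"
proof -
  have "0 \<le> sample_var X k \<omega>" by (simp add: sample_var_def sum_nonneg)
  then show ?thesis using \<Lambda>_ge_1 by (simp add: u_hat_def)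
qed

lemma walk_small:
  assumes "m \<le> k" "\<omega> \<in> space M - exceptional"
  shows "\<bar>W k \<omega>\<bar> \<le> real k powr (1/2 + \<eta>)"
    and "real k * (v - 1 / (4 * \<Lambda>)) \<le> (\<Sum>j=1..k. (X j \<omega> - \<mu>)\<^sup>2)"
proof -
  have "\<omega> \<notin> exceptional_at (Suc (k - 1))" using assms by (auto simp: exceptional_def)
  then have "\<omega> \<notin> exceptional_at k" using assms m_ge by simp
  then show "\<bar>W k \<omega>\<bar> \<le> real k powr (1/2 + \<eta>)"
    "real k * (v - 1 / (4 * \<Lambda>)) \<le> (\<Sum>j=1..k. (X j \<omega> - \<mu>)\<^sup>2)"
    using assms by (auto simp: exceptional_at_def)
qed

text \<open>The slack \<open>1/\<Lambda>\<close> splits as \<open>1/(2\<Lambda>)\<close>, which goes into \<open>s\<close>, plus \<open>1/(4\<Lambda>)\<close> for the sum of squares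
plus \<open>1/(4\<Lambda>)\<close> for the squared sample mean.\<close>

lemma u_hat_ge:
  assumes "m \<le> k" "\<omega> \<in> space M - exceptional"
  shows "real k * s \<le> u_hat X m k \<omega>"
proof -
  have k: "1 \<le> real k" using assms m_ge by simp
  let ?S = "centred_sum X \<mu> k \<omega>"
  have "\<bar>?S\<bar> \<le> real k powr (1/2 + \<eta>) + real k powr (1/2 - 2 * \<eta>)"
    using bias_small[OF assms] walk_small(1)[OF assms] by linarith
  also have "real k powr (1/2 - 2 * \<eta>) \<le> real k powr (1/2 + \<eta>)"
    using k \<eta>_bounds by (intro powr_mono) auto
  finally have "\<bar>?S\<bar> \<le> 2 * real k powr (1/2 + \<eta>)" by simp
  then have "\<bar>?S / real k\<bar> \<le> 2 * real k powr (1/2 + \<eta>) / real k powr 1"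
    using k by (simp add: divide_right_mono)
  also have "\<dots> = 2 * real k powr (\<eta> - 1/2)" unfolding times_divide_eq_right[symmetric] powr_diff[symmetric] by simp
  also have "\<dots> \<le> 2 * real k powr (- (1/4))" using k \<eta>_bounds by (simp add: powr_mono)
  also have "\<dots> \<le> 2 * real m powr (- (1/4))"
    using assms m_ge by (intro mult_left_mono powr_mono2') auto
  also have "\<dots> \<le> 1 / (4 * \<Lambda>)"
    using quarter_powr_le by simp
  finally have Sk: "\<bar>?S / real k\<bar> \<le> 1 / (4 * \<Lambda>)" .
  have "(?S / real k)\<^sup>2 \<le> (1 / (4 * \<Lambda>))\<^sup>2" using power_mono[OF Sk abs_ge_zero, of 2] unfolding power2_abs .
  also have "\<dots> \<le> 1 / (4 * \<Lambda>)"
  proof -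
    have "0 \<le> 1 / (4 * \<Lambda>)" "1 / (4 * \<Lambda>) \<le> 1" using \<Lambda>_ge_1 by auto
    from mult_left_mono[OF this(2) this(1)] show ?thesis by (simp add: power2_eq_square)
  qed
  finally have mean2: "(?S / real k)\<^sup>2 \<le> 1 / (4 * \<Lambda>)" .
  have "v - 1 / (4 * \<Lambda>) \<le> (\<Sum>j=1..k. (X j \<omega> - \<mu>)\<^sup>2) / real k"
    using walk_small(2)[OF assms] k by (simp add: pos_le_divide_eq mult.commute)
  then have "v - 1 / (4 * \<Lambda>) - 1 / (4 * \<Lambda>) \<le> sample_var X k \<omega>"
    using mean2 sample_var_centred[of k X \<omega> \<mu>] k by simp
  then have "s \<le> sample_var X k \<omega> + 1 / \<Lambda>" by (simp add: s_def field_simps)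
  then show ?thesis unfolding u_hat_def using k by (intro mult_left_mono) auto
qed

text \<open>Three replacements: the variance estimate by \<open>k s\<close> (the score decreases in \<open>V\<close>), the sum by the
truncated walk (a shift by the bias), and the full Gaussian integral by the one over
\<open>\<bar>l\<bar> \<le> c k\<close>. The last is possible since \<open>\<bar>W k\<bar>\<close> is of smaller order than \<open>c k * k\<close>.\<close>

lemma evalue_le_mixture:
  assumes "0 < \<rho>" "m \<le> k" "\<omega> \<in> space M - exceptional"
  shows "ennreal (mixture_evalue \<rho> (centred_sum X \<mu> k \<omega>) (u_hat X m k \<omega>)) \<le>
    ennreal (exp (3 * \<Lambda> * real m powr (- \<eta>))) * (mixture \<rho> k \<omega> + ennreal (exp (- (real m powr (3 * \<eta>)))))"
proof -
  have k: "1 \<le> real k" using assms m_ge by simp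
  have s: "1 / (2 * \<Lambda>) \<le> s" using v_nonneg by (simp add: s_def)
  have "0 < 1 / (2 * \<Lambda>)" using \<Lambda>_ge_1 by simp
  then have s0: "0 < s" using s by linarith
  have V: "0 < real k * s" using k s0 by simp
  define w where "w = W k \<omega>"
  define D where "D = centred_sum X \<mu> k \<omega> - w"
  have w: "\<bar>w\<bar> \<le> real k powr (1/2 + \<eta>)" using walk_small(1)[OF assms(2,3)] by (simp add: w_def)
  have D: "\<bar>D\<bar> \<le> real k powr (1/2 - 2 * \<eta>)" using bias_small[OF assms(2,3)] by (simp add: D_def w_def)
  have \<eta>k: "8 * \<Lambda> \<le> real k powr \<eta>"
  proof -
    have "real m powr \<eta> \<le> real k powr \<eta>" using assms \<eta>_bounds by (intro powr_mono2) auto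
    then show ?thesis using \<Lambda>_le_\<eta> by linarith
  qed
  \<comment> \<open>The bias changes the exponent by a bounded multiple of \<open>\<Lambda> * k powr (- \<eta>)\<close>.\<close>
  have shift: "(2 * \<bar>w\<bar> * \<bar>D\<bar> + D\<^sup>2) / (2 * (real k * s)) \<le> 3 * \<Lambda> * real m powr (- \<eta>)"
  proof -
    have "\<bar>w\<bar> * \<bar>D\<bar> \<le> real k powr (1/2 + \<eta>) * real k powr (1/2 - 2 * \<eta>)"
      using w D by (intro mult_mono) auto
    also have "\<dots> = real k powr (1 - \<eta>)" unfolding powr_add[symmetric] by simp
    finally have wD: "\<bar>w\<bar> * \<bar>D\<bar> \<le> real k powr (1 - \<eta>)" .
    have "D\<^sup>2 = \<bar>D\<bar> * \<bar>D\<bar>" by (simp add: power2_eq_square)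
    also have "\<dots> \<le> real k powr (1/2 - 2 * \<eta>) * real k powr (1/2 - 2 * \<eta>)"
      using D by (intro mult_mono) auto
    also have "\<dots> \<le> real k powr (1 - \<eta>)" unfolding powr_add[symmetric] using k \<eta>_bounds by (intro powr_mono) auto
    finally have "2 * \<bar>w\<bar> * \<bar>D\<bar> + D\<^sup>2 \<le> 3 * real k powr (1 - \<eta>)" using wD by simp
    then have "(2 * \<bar>w\<bar> * \<bar>D\<bar> + D\<^sup>2) / (2 * (real k * s)) \<le> 3 * real k powr (1 - \<eta>) / (2 * (real k * s))"
      using V by (intro divide_right_mono) auto
    also have "\<dots> \<le> 3 * real k powr (1 - \<eta>) / (2 * (real k * (1 / (2 * \<Lambda>))))"
      using V k s \<Lambda>_ge_1 by (intro divide_left_mono mult_left_mono) auto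
    also have "\<dots> = 3 * \<Lambda> * (real k powr (1 - \<eta>) / real k powr 1)" using k \<Lambda>_ge_1 by (simp add: field_simps)
    also have "\<dots> = 3 * \<Lambda> * real k powr (- \<eta>)" unfolding powr_diff[symmetric] by simp
    also have "\<dots> \<le> 3 * \<Lambda> * real m powr (- \<eta>)"
      using assms m_ge \<eta>_bounds \<Lambda>_ge_1 by (intro mult_left_mono powr_mono2') auto
    finally show ?thesis .
  qed
  have ck: "c k = real k powr (2 * \<eta> - 1/2)" using assms by (simp add: c_def max_absorb1)
  have cV: "real k powr (1/2 + \<eta>) \<le> c k * (real k * s) / 4"
  proof -
    have "real k powr (1/2 + \<eta>) = real k powr (1/2 + 2 * \<eta>) / real k powr \<eta>"
      unfolding powr_diff[symmetric] by (simp add: add.commute)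
    also have "\<dots> \<le> real k powr (1/2 + 2 * \<eta>) / (8 * \<Lambda>)"
      using \<eta>k \<Lambda>_ge_1 k by (intro divide_left_mono) (auto intro!: mult_pos_pos)
    also have "real k powr (1/2 + 2 * \<eta>) = c k * real k powr 1"
      unfolding ck powr_add[symmetric] by simp
    also have "c k * real k powr 1 / (8 * \<Lambda>) = c k * (real k * (1 / (2 * \<Lambda>))) / 4" using k by simp
    also have "\<dots> \<le> c k * (real k * s) / 4"
      using s k c_pos[of k] by (intro divide_right_mono mult_left_mono) auto
    finally show ?thesis .
  qed
  have c2V: "real m powr (3 * \<eta>) \<le> (c k)\<^sup>2 * (real k * s) / 4"
  proof -
    have "real m powr (3 * \<eta>) \<le> real k powr (3 * \<eta>)" using assms \<eta>_bounds by (intro powr_mono2) auto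
    also have "\<dots> = c k * real k powr (1/2 + \<eta>)" unfolding ck powr_add[symmetric] by simp
    also have "\<dots> \<le> c k * (c k * (real k * s) / 4)" using cV c_pos[of k] by (intro mult_left_mono) auto
    finally show ?thesis by (simp add: power2_eq_square mult_ac)
  qed
  have "mixture_evalue \<rho> (centred_sum X \<mu> k \<omega>) (u_hat X m k \<omega>) \<le> mixture_evalue \<rho> (w + D) (real k * s)"
    using assms V u_hat_ge[OF assms(2,3)] by (simp add: D_def mixture_evalue_antimono)
  also have "\<dots> \<le> exp ((2 * \<bar>w\<bar> * \<bar>D\<bar> + D\<^sup>2) / (2 * (real k * s))) * mixture_evalue \<rho> w (real k * s)"
    by (rule mixture_evalue_shift[OF assms(1) V])
  also have "\<dots> \<le> exp (3 * \<Lambda> * real m powr (- \<eta>)) * mixture_evalue \<rho> w (real k * s)"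
    using shift assms V by (intro mult_right_mono mixture_evalue_nonneg) auto
  finally have "ennreal (mixture_evalue \<rho> (centred_sum X \<mu> k \<omega>) (u_hat X m k \<omega>)) \<le>
      ennreal (exp (3 * \<Lambda> * real m powr (- \<eta>)) * mixture_evalue \<rho> w (real k * s))" by (rule ennreal_leI)
  also have "\<dots> = ennreal (exp (3 * \<Lambda> * real m powr (- \<eta>))) * ennreal (mixture_evalue \<rho> w (real k * s))"
    using assms V by (intro ennreal_mult mixture_evalue_nonneg) auto
  also have "ennreal (mixture_evalue \<rho> w (real k * s)) \<le> mixture \<rho> k \<omega> + ennreal (exp (- (real m powr (3 * \<eta>))))"
  proof -
    have "ennreal (mixture_evalue \<rho> w (real k * s)) \<le> mixture \<rho> k \<omega> + ennreal (exp (- ((c k)\<^sup>2 * (real k * s) / 4)))"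
      unfolding mixture_def L_def w_def[symmetric]
      using assms V c_pos[of k] w cV by (intro mixture_evalue_le_truncated) auto
    also have "\<dots> \<le> mixture \<rho> k \<omega> + ennreal (exp (- (real m powr (3 * \<eta>))))"
      using c2V by (intro add_left_mono ennreal_leI) simp
    finally show ?thesis .
  qed
  finally show ?thesis by (simp add: mult_left_mono)
qed

lemma expected_miscoverage_le:
  assumes "0 < \<rho>" "0 < r" "stopping_time F \<tau>"
  shows "(\<integral>\<^sup>+\<omega>. (SUP \<alpha>\<in>{r<..}. ennreal (of_bool (\<mu> \<notin> conf_interval X \<rho> m (max (\<tau> \<omega>) m) \<alpha> \<omega>) / \<alpha>)) \<partial>M)
    \<le> ennreal (1 / r * (exceptional_const * real m powr (- (\<delta> / 4))) +
        exp (3 * \<Lambda> * real m powr (- \<eta>)) * (1 + exp (- (real m powr (3 * \<eta>)))))"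
proof -
  define \<sigma> where "\<sigma> \<omega> = max (\<tau> \<omega>) m" for \<omega>
  have \<sigma>: "stopping_time F \<sigma>"
    unfolding \<sigma>_def using assms(3) stopping_time_const by (rule stopping_time_max)
  have [measurable]: "\<sigma> \<in> measurable M (count_space UNIV)"
    using sets_F_subset \<sigma> by (intro stopping_time_natural_filtration_measurable[where F=F]) auto
  have [measurable]: "(\<lambda>\<omega>. mixture \<rho> (\<sigma> \<omega>) \<omega>) \<in> borel_measurable M"
    by (rule measurable_compose_countable) auto
  define e where "e = exp (3 * \<Lambda> * real m powr (- \<eta>))"
  define t where "t = exp (- (real m powr (3 * \<eta>)))"
  have "(\<integral>\<^sup>+\<omega>. (SUP \<alpha>\<in>{r<..}. ennreal (of_bool (\<mu> \<notin> conf_interval X \<rho> m (\<sigma> \<omega>) \<alpha> \<omega>) / \<alpha>)) \<partial>M)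
    \<le> (\<integral>\<^sup>+\<omega>. ennreal (1 / r) * indicator exceptional \<omega> + ennreal e * (mixture \<rho> (\<sigma> \<omega>) \<omega> + ennreal t) \<partial>M)"
  proof (rule nn_integral_mono)
    fix \<omega> assume \<omega>: "\<omega> \<in> space M"
    show "(SUP \<alpha>\<in>{r<..}. ennreal (of_bool (\<mu> \<notin> conf_interval X \<rho> m (\<sigma> \<omega>) \<alpha> \<omega>) / \<alpha>))
      \<le> ennreal (1 / r) * indicator exceptional \<omega> + ennreal e * (mixture \<rho> (\<sigma> \<omega>) \<omega> + ennreal t)"
    proof (cases "\<omega> \<in> exceptional")
      case True
      then show ?thesis using SUP_miscoverage_le_crude[OF assms(2), of \<mu> "\<lambda>\<alpha>. conf_interval X \<rho> m (\<sigma> \<omega>) \<alpha> \<omega>"]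
        by (simp add: add_increasing2)
    next
      case False
      have k: "m \<le> \<sigma> \<omega>" "1 \<le> \<sigma> \<omega>" using m_ge by (auto simp: \<sigma>_def)
      have "(SUP \<alpha>\<in>{r<..}. ennreal (of_bool (\<mu> \<notin> conf_interval X \<rho> m (\<sigma> \<omega>) \<alpha> \<omega>) / \<alpha>))
        \<le> ennreal (mixture_evalue \<rho> (centred_sum X \<mu> (\<sigma> \<omega>) \<omega>) (u_hat X m (\<sigma> \<omega>) \<omega>))"
        by (rule SUP_miscoverage_le[OF assms(1) k(2) u_hat_nonneg assms(2)])
      also have "\<dots> \<le> ennreal e * (mixture \<rho> (\<sigma> \<omega>) \<omega> + ennreal t)"
        unfolding e_def t_def using \<omega> False by (intro evalue_le_mixture[OF assms(1) k(1)]) auto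
      finally show ?thesis using False by simp
    qed
  qed
  also have "\<dots> = ennreal (1 / r) * emeasure M exceptional + ennreal e * ((\<integral>\<^sup>+\<omega>. mixture \<rho> (\<sigma> \<omega>) \<omega> \<partial>M) + ennreal t)"
    by (simp add: nn_integral_add nn_integral_cmult nn_integral_cmult_indicator emeasure_space_1)
  also have "\<dots> \<le> ennreal (1 / r) * ennreal (exceptional_const * real m powr (- (\<delta> / 4))) + ennreal e * (1 + ennreal t)"
    using prob_exceptional nn_integral_mixture_stopped[OF assms(1) \<sigma>] by (intro add_mono mult_left_mono) auto
  also have "\<dots> = ennreal (1 / r * (exceptional_const * real m powr (- (\<delta> / 4))) + e * (1 + t))"
  proof -
    have "0 \<le> e" "0 \<le> t" by (auto simp: e_def t_def)
    then show ?thesis using assms exceptional_const_nonneg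
      by (simp add: ennreal_mult[symmetric] ennreal_plus[symmetric] flip: ennreal_1 del: ennreal_plus ennreal_1)
  qed
  finally show ?thesis by (simp add: \<sigma>_def e_def t_def)
qed

end

section \<open>From one law to the uniform statement\<close>

text \<open>The hypothesis bounds \<open>\<bar>X\<bar> powr (2 + \<delta>)\<close>; centring by the common \<open>\<mu>\<close> costs the factor
\<open>2 powr (2 + \<delta>)\<close> and an additive constant.\<close>

lemma uniform_centred_moment_bound:
  assumes "\<P> \<subseteq> moment_class (2 + \<delta>) \<mu>" "uniformly_bounded_moment \<P> (2 + \<delta>)" "0 < \<delta>"
  shows "\<exists>K. \<forall>P\<in>\<P>. (\<integral>x. \<bar>x - \<mu>\<bar> powr (2 + \<delta>) \<partial>P) \<le> K"
proof -
  define B where "B = (SUP P\<in>\<P>. \<integral>\<^sup>+x. ennreal (\<bar>x\<bar> powr (2 + \<delta>)) \<partial>P)"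
  define T where "T = ennreal (2 powr (2 + \<delta>)) * (B + ennreal (\<bar>\<mu>\<bar> powr (2 + \<delta>)))"
  have "B < \<infinity>" using assms(2) by (simp add: B_def uniformly_bounded_moment_def)
  then have T: "T < \<top>" by (simp add: T_def ennreal_mult_less_top)
  have "(\<integral>x. \<bar>x - \<mu>\<bar> powr (2 + \<delta>) \<partial>P) \<le> enn2real T" if P: "P \<in> \<P>" for P
  proof -
    from P assms(1) have "P \<in> moment_class (2 + \<delta>) \<mu>" by auto
    then have P': "prob_space P" "sets P = sets borel" "integrable P (\<lambda>x. \<bar>x - \<mu>\<bar> powr (2 + \<delta>))"
      by (auto simp: moment_class_def)
    interpret prob_space P by (rule P')
    have [measurable_cong]: "sets P = sets borel" by (rule P')
    have pointwise: "\<bar>x - \<mu>\<bar> powr (2 + \<delta>) \<le> 2 powr (2 + \<delta>) * (\<bar>x\<bar> powr (2 + \<delta>) + \<bar>\<mu>\<bar> powr (2 + \<delta>))" for x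
    proof -
      have "\<bar>x - \<mu>\<bar> powr (2 + \<delta>) \<le> (2 * max \<bar>x\<bar> \<bar>\<mu>\<bar>) powr (2 + \<delta>)"
        using assms(3) by (intro powr_mono2) auto
      also have "\<dots> = 2 powr (2 + \<delta>) * max \<bar>x\<bar> \<bar>\<mu>\<bar> powr (2 + \<delta>)" by (simp add: powr_mult)
      also have "\<dots> \<le> 2 powr (2 + \<delta>) * (\<bar>x\<bar> powr (2 + \<delta>) + \<bar>\<mu>\<bar> powr (2 + \<delta>))"
        by (intro mult_left_mono) (auto simp: max_def)
      finally show ?thesis .
    qed
    have "ennreal (\<integral>x. \<bar>x - \<mu>\<bar> powr (2 + \<delta>) \<partial>P) = (\<integral>\<^sup>+x. ennreal (\<bar>x - \<mu>\<bar> powr (2 + \<delta>)) \<partial>P)"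
      using P'(3) by (intro nn_integral_eq_integral[symmetric]) auto
    also have "\<dots> \<le> (\<integral>\<^sup>+x. ennreal (2 powr (2 + \<delta>)) * (ennreal (\<bar>x\<bar> powr (2 + \<delta>)) + ennreal (\<bar>\<mu>\<bar> powr (2 + \<delta>))) \<partial>P)"
      using pointwise by (intro nn_integral_mono)
        (simp add: ennreal_mult[symmetric] ennreal_plus[symmetric] ennreal_leI del: ennreal_plus)
    also have "\<dots> = ennreal (2 powr (2 + \<delta>)) *
        ((\<integral>\<^sup>+x. ennreal (\<bar>x\<bar> powr (2 + \<delta>)) \<partial>P) + ennreal (\<bar>\<mu>\<bar> powr (2 + \<delta>)))"
      by (simp add: nn_integral_cmult nn_integral_add emeasure_space_1)
    also have "\<dots> \<le> T"
      unfolding T_def B_def using P by (intro mult_left_mono add_right_mono SUP_upper) auto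
    also have "T = ennreal (enn2real T)" using T by simp
    finally show ?thesis by (simp add: ennreal_le_iff)
  qed
  then show ?thesis by blast
qed

lemma large_index_sampleI:
  assumes P: "P \<in> moment_class (2 + \<delta>) \<mu>" and iid: "iid_with_law N X P" and "0 < \<delta>"
    and K: "(\<integral>x. \<bar>x - \<mu>\<bar> powr (2 + \<delta>) \<partial>P) \<le> K" and m: "large_index \<delta> K m"
  shows "large_index_sample N X \<mu> \<delta> K (\<integral>x. (x - \<mu>)\<^sup>2 \<partial>P) m"
proof -
  interpret prob_space N using iid by (simp add: iid_with_law_def)
  interpret P: prob_space P using P by (simp add: moment_class_def)
  have ind: "indep_vars (\<lambda>_. borel) X {1..}" and law: "\<And>i. 1 \<le> i \<Longrightarrow> distr N borel (X i) = P"
    using iid by (auto simp: iid_with_law_def)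
  have P': "sets P = sets borel" "integrable P (\<lambda>x. x)" "(\<integral>x. x \<partial>P) = \<mu>"
     "integrable P (\<lambda>x. \<bar>x - \<mu>\<bar> powr (2 + \<delta>))" using P by (auto simp: moment_class_def)
  have X: "X i \<in> borel_measurable N" if "1 \<le> i" for i using ind that by (auto simp: indep_vars_def)
  have int: "integrable P f \<longleftrightarrow> integrable N (\<lambda>\<omega>. f (X i \<omega>))"
    and exp: "(\<integral>x. f x \<partial>P) = (\<integral>\<omega>. f (X i \<omega>) \<partial>N)"
    if "1 \<le> i" "f \<in> borel_measurable borel" for i and f :: "real \<Rightarrow> real"
    using integrable_distr_eq[OF X[OF that(1)] that(2)] integral_distr[OF X[OF that(1)] that(2)]
    unfolding law[OF that(1)] by auto
  have moment: "moment_variable N (\<lambda>\<omega>. X i \<omega> - \<mu>) \<delta> K" if i: "1 \<le> i" for i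
  proof unfold_locales
    have "integrable P (\<lambda>x. x - \<mu>)" by (intro Bochner_Integration.integrable_diff P' P.integrable_const)
    then show "integrable N (\<lambda>\<omega>. X i \<omega> - \<mu>)" by (rule iffD1[OF int[OF i], rotated]) measurable
    have mean: "(\<integral>x. x - \<mu> \<partial>P) = 0" using P'(2,3) by (simp add: P.prob_space)
    have "(\<lambda>x. x - \<mu>) \<in> borel_measurable borel" by measurable
    from exp[OF i this] mean show "expectation (\<lambda>\<omega>. X i \<omega> - \<mu>) = 0" by (rule trans[OF sym])
    define f where "f x = \<bar>x - \<mu>\<bar> powr (2 + \<delta>)" for x :: real
    have f: "f \<in> borel_measurable borel" unfolding f_def by simp
    have "integrable P f" "(\<integral>x. f x \<partial>P) \<le> K" using P'(4) K unfolding f_def .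
    then have "integrable N (\<lambda>\<omega>. f (X i \<omega>))" "expectation (\<lambda>\<omega>. f (X i \<omega>)) \<le> K"
      unfolding int[OF i f] exp[OF i f] .
    then show "integrable N (\<lambda>\<omega>. \<bar>X i \<omega> - \<mu>\<bar> powr (2 + \<delta>))"
      and "expectation (\<lambda>\<omega>. \<bar>X i \<omega> - \<mu>\<bar> powr (2 + \<delta>)) \<le> K"
      unfolding f_def .
    show "0 < \<delta>" by fact
  qed
  have variance: "expectation (\<lambda>\<omega>. (X i \<omega> - \<mu>)\<^sup>2) = (\<integral>x. (x - \<mu>)\<^sup>2 \<partial>P)" if i: "1 \<le> i" for i
    using exp[OF i, of "\<lambda>x. (x - \<mu>)\<^sup>2"] by simp
  show ?thesis
    by (intro large_index_sample.intro moment_sequence.intro independent_sequence.intro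
        large_index_sample_axioms.intro moment_sequence_axioms.intro independent_sequence_axioms.intro
        prob_space_axioms ind m moment variance)
qed

text \<open>The first summand is of order \<open>m powr (- \<delta>/100)\<close>: this is the gap between \<open>\<delta>/4\<close> and \<open>0.24 \<delta>\<close>.\<close>

lemma risk_bound_tendsto:
  fixes B C \<delta> p :: real
  assumes "0 < \<delta>" "0 < C" "0 < p"
  shows "((\<lambda>m. 1 / (C * real m powr (- 0.24 * \<delta>)) * (B * real m powr (- (\<delta> / 4))) +
     exp (3 * ln (real m) * real m powr (- p)) * (1 + exp (- (real m powr (3 * p))))) \<longlongrightarrow> 1) sequentially"
proof -
  have 1: "((\<lambda>m. B / C * real m powr (- (\<delta> / 100))) \<longlongrightarrow> 0) sequentially"
  proof -
    have "((\<lambda>m. real m powr (- (\<delta> / 100))) \<longlongrightarrow> 0) sequentially" using assms by real_asymp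
    from tendsto_mult_left[OF this, of "B / C"] show ?thesis by simp
  qed
  have 2: "((\<lambda>m. exp (3 * ln (real m) * real m powr (- p)) * (1 + exp (- (real m powr (3 * p))))) \<longlongrightarrow> 1) sequentially"
    using assms(3) by real_asymp
  have "1 / (C * real m powr (- 0.24 * \<delta>)) * (B * real m powr (- (\<delta> / 4))) = B / C * real m powr (- (\<delta> / 100))" for m
  proof -
    have "real m powr (- (\<delta> / 4)) / real m powr (- 0.24 * \<delta>) = real m powr (- (\<delta> / 100))"
      unfolding powr_diff[symmetric] by (simp add: field_simps)
    moreover have "1 / (C * x) * (B * y) = B / C * (y / x)" for x y :: real by simp
    ultimately show ?thesis by (simp only:)
  qed
  then show ?thesis using tendsto_add[OF 1 2] by simp
qed

theorem theorem4p5: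
  fixes \<Omega> :: "'w measure" and X :: "nat \<Rightarrow> 'w \<Rightarrow> real"
    and \<PP> :: "real measure \<Rightarrow> 'w measure" and \<P> :: "real measure set"
    and \<mu> \<delta> C \<rho> :: real
  assumes "\<delta> > 0"
    and "\<P> \<subseteq> moment_class (2 + \<delta>) \<mu>"
    and "uniformly_bounded_moment \<P> (2 + \<delta>)"
    and "iid_model \<Omega> X \<PP> \<P>"
    and "C > 0" and "\<rho> > 0"
  shows "uniform_asymp_posthoc_conf_seq \<Omega> X \<PP> \<P> \<mu> (conf_interval X \<rho>)
           (\<lambda>m. C * real m powr (- 0.24 * \<delta>))"
  unfolding uniform_asymp_posthoc_conf_seq_def
proof (intro allI impI)
  fix \<tau> :: "'w \<Rightarrow> nat" assume \<tau>: "stopping_time (natural_filtration \<Omega> X) \<tau>"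
  obtain K where K: "\<And>P. P \<in> \<P> \<Longrightarrow> (\<integral>x. \<bar>x - \<mu>\<bar> powr (2 + \<delta>) \<partial>P) \<le> K"
    using uniform_centred_moment_bound[OF assms(2,3,1)] by blast
  define f where "f m = C * real m powr (- 0.24 * \<delta>)" for m
  define B where "B = (K + 2 * exp (1 + K / 2) + 1) * (\<Sum>i. real (Suc i) powr (- (1 + \<delta> / 20)))"
  define R where "R m = 1 / f m * (B * real m powr (- (\<delta> / 4))) +
     exp (3 * ln (real m) * real m powr (- eta \<delta>)) * (1 + exp (- (real m powr (3 * eta \<delta>))))" for m
  let ?risk = "\<lambda>m P. \<integral>\<^sup>+\<omega>. (SUP \<alpha>\<in>{f m<..}. ennreal (of_bool (\<mu> \<notin> conf_interval X \<rho> m (max (\<tau> \<omega>) m) \<alpha> \<omega>) / \<alpha>)) \<partial>\<PP> P"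
  have "eventually (\<lambda>m. (SUP P\<in>\<P>. ?risk m P) \<le> ennreal (R m)) sequentially"
    using eventually_large_index[OF assms(1), of K]
  proof eventually_elim
    case (elim m)
    show ?case
    proof (rule SUP_least)
      fix P assume P: "P \<in> \<P>"
      then have iid: "iid_with_law (\<PP> P) X P" and sets: "sets (\<PP> P) = sets \<Omega>"
        using assms(4) by (auto simp: iid_model_def)
      interpret large_index_sample "\<PP> P" X \<mu> \<delta> K "\<integral>x. (x - \<mu>)\<^sup>2 \<partial>P" m
        using P assms(2) by (intro large_index_sampleI[OF _ iid assms(1) K[OF P] elim]) auto
      have "natural_filtration (\<PP> P) X = natural_filtration \<Omega> X"
        unfolding natural_filtration_def using sets_eq_imp_space_eq[OF sets] by auto
      then have "stopping_time (natural_filtration (\<PP> P) X) \<tau>" using \<tau> by simp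
      moreover have "0 < f m" using assms(5) m_ge by (simp add: f_def)
      ultimately show "?risk m P \<le> ennreal (R m)"
        using expected_miscoverage_le[OF assms(6)] by (simp add: R_def B_def exceptional_const_def)
    qed
  qed
  then have "limsup (\<lambda>m. SUP P\<in>\<P>. ?risk m P) \<le> limsup (\<lambda>m. ennreal (R m))"
    by (rule Limsup_mono)
  also have "R \<longlonglongrightarrow> 1"
    unfolding R_def f_def using eta_bounds(1)[OF assms(1)] by (intro risk_bound_tendsto assms) auto
  then have "(\<lambda>m. ennreal (R m)) \<longlonglongrightarrow> 1" using tendsto_ennrealI[of R 1] by simp
  then have "limsup (\<lambda>m. ennreal (R m)) = 1" by (intro lim_imp_Limsup) auto
  finally show "limsup (\<lambda>m. SUP P\<in>\<P>. \<integral>\<^sup>+\<omega>. (SUP \<alpha>\<in>{C * real m powr (- 0.24 * \<delta>)<..}.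
      ennreal (of_bool (\<mu> \<notin> conf_interval X \<rho> m (max (\<tau> \<omega>) m) \<alpha> \<omega>) / \<alpha>)) \<partial>\<PP> P) \<le> 1"
    by (simp add: f_def)
qed

end
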